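(* Let $1<B<2$ and $0<\kappa<\min\left(\frac{B^2}{4},\frac12\right)$. There exist $\beta_0>0$ and constants $c_1,c_2>0$ such that for every $0\le\beta\le\beta_0$ and every integer $n\ge0$: for any non-empty subset $I\subset\{1,\dots,2^n\}$, $$\left(e^{-c_1\beta^2}\right)^{|I|}\mathbf E_n[\delta_I]\le \mathbf E_n\left[\delta_I\,e^{H^{\mathrm a}_{n,h_c^{\mathrm a}}}\right]\le \left(e^{c_1\beta^2}\right)^{|I|}\mathbf E_n[\delta_I],$$ where $\delta_I:=\prod_{i\in I}\delta_i$ and $h_c^{\mathrm a}=h_c^{\mathrm a}(\beta)$ is the annealed critical point; and, in the case $I=\emptyset$, $$e^{-c_2\beta^2(4\kappa/B^2)^n}\le Z^{\mathrm a}_{n,h_c^{\mathrm a}}\le 1.$$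
   Context: For $n\ge 0$, $\mathbf P_n$ (expectation $\mathbf E_n$) is the law of a random vector $(\delta_1,\dots,\delta_{2^n})\in\{0,1\}^{2^n}$ defined recursively: under $\mathbf P_0$, $\delta_1=1$; under $\mathbf P_{n+1}$, with probability $\frac{B-1}{B}$ all $\delta_i$ are $0$, and with probability $\frac1B$ the two vectors $(\delta_1,\dots,\delta_{2^n})$ and $(\delta_{2^n+1},\dots,\delta_{2^{n+1}})$ are independent, each with law $\mathbf P_n$. Set $S_n=\sum_{i=1}^{2^n}\delta_i$. For $i,j\in\mathbb N=\{1,2,\dots\}$, the hierarchical distance $d(i,j)$ is the smallest $p\ge0$ such that $i$ and $j$ lie in a common block $\{(k-1)2^p+1,\dots,k2^p\}$, $k\in\mathbb N$. Set $\kappa_{ij}=\kappa^{d(i,j)}$ (so $\kappa_{ii}=1$). For $\beta\ge0$, $h\in\mathbb R$, the annealed Hamiltonian and partition function are $$H^{\mathrm a}_{n,h}=hS_n+\frac{\beta^2}{2}\sum_{i,j=1}^{2^n}\kappa_{ij}\delta_i\delta_j,\qquad Z^{\mathrm a}_{n,h}=\mathbf E_n\left[e^{H^{\mathrm a}_{n,h}}\right].$$ The annealed free energy is $\mathtt F^{\mathrm a}(\beta,h)=\lim_{n\to\infty}2^{-n}\log Z^{\mathrm a}_{n,h}$ (the limit exists, is finite and non-negative), and the annealed critical point is $h_c^{\mathrm a}(\beta)=\sup\{h:\mathtt F^{\mathrm a}(\beta,h)=0\}$, which is finite. *)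

theory Defs
  imports "HOL-Probability.Probability"
begin

text \<open>
  A configuration of $\{0,1\}^{2^n}$ is a function of type \<^typ>\<open>nat \<Rightarrow> real\<close> that takes the values
  0 and 1 on the sites \<open>{1..2^n}\<close> and is 0 elsewhere (see lemma \<open>set_hier_pmf\<close>).
  The parameter of the Bernoulli law, \<open>1 / B\<close>, lies in the unit interval whenever \<open>B \<ge> 1\<close>.
\<close>

primrec hier_pmf :: "real \<Rightarrow> nat \<Rightarrow> (nat \<Rightarrow> real) pmf" where
  "hier_pmf B 0 = return_pmf (\<lambda>i. if i = 1 then 1 else 0)"
| "hier_pmf B (Suc n) =
     bind_pmf (bernoulli_pmf (1 / B)) (\<lambda>b.
       if b then map_pmf (\<lambda>(\<delta>, \<delta>') i. if i \<le> 2 ^ n then \<delta> i else \<delta>' (i - 2 ^ n))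
                   (pair_pmf (hier_pmf B n) (hier_pmf B n))
       else return_pmf (\<lambda>_. 0))"

lemma set_hier_pmf:
  "set_pmf (hier_pmf B n) \<subseteq> PiE_dflt {1..2 ^ n} 0 (\<lambda>_. {0, 1})"
proof (induction n)
  case 0
  show ?case by (auto simp: PiE_dflt_def)
next
  case (Suc n)
  show ?case
  proof
    fix x assume "x \<in> set_pmf (hier_pmf B (Suc n))"
    then consider "x = (\<lambda>_. 0)"
      | y z where "y \<in> set_pmf (hier_pmf B n)" "z \<in> set_pmf (hier_pmf B n)"
          "x = (\<lambda>i. if i \<le> 2 ^ n then y i else z (i - 2 ^ n))"
      by (auto split: if_splits)
    then show "x \<in> PiE_dflt {1..2 ^ Suc n} 0 (\<lambda>_. {0, 1})"
    proof cases
      case 1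
      then show ?thesis by (auto simp: PiE_dflt_def)
    next
      case 2
      have y: "y i \<in> {0, 1}" "i \<notin> {1..2 ^ n} \<Longrightarrow> y i = 0"
        and z: "z i \<in> {0, 1}" "i \<notin> {1..2 ^ n} \<Longrightarrow> z i = 0" for i
        using Suc 2(1,2) by (fastforce simp: PiE_dflt_def)+
      have "x i \<in> {0, 1}" for i
        using y(1)[of i] z(1)[of "i - 2 ^ n"] 2(3) by auto
      moreover have "x i = 0" if "i \<notin> {1..2 ^ Suc n}" for i
      proof (cases "i \<le> 2 ^ n")
        case True
        then show ?thesis using that y(2)[of i] 2(3) by auto
      next
        case False
        then have "i - 2 ^ n \<notin> {1..2 ^ n}" using that by auto
        then show ?thesis using False z(2)[of "i - 2 ^ n"] 2(3) by simp
      qed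
      ultimately show ?thesis by (auto simp: PiE_dflt_def)
    qed
  qed
qed

definition hier_dist :: "nat \<Rightarrow> nat \<Rightarrow> nat" where
  "hier_dist i j =
     (LEAST p. \<exists>k\<ge>1. i \<in> {(k - 1) * 2 ^ p + 1..k * 2 ^ p} \<and> j \<in> {(k - 1) * 2 ^ p + 1..k * 2 ^ p})"

definition num_contacts :: "nat \<Rightarrow> (nat \<Rightarrow> real) \<Rightarrow> real" where
  "num_contacts n \<delta> = (\<Sum>i = 1..2 ^ n. \<delta> i)"

definition annealed_hamiltonian :: "real \<Rightarrow> real \<Rightarrow> real \<Rightarrow> nat \<Rightarrow> (nat \<Rightarrow> real) \<Rightarrow> real" where
  "annealed_hamiltonian \<kappa> \<beta> h n \<delta> =
     h * num_contacts n \<delta> +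
     \<beta>\<^sup>2 / 2 * (\<Sum>i = 1..2 ^ n. \<Sum>j = 1..2 ^ n. \<kappa> ^ hier_dist i j * \<delta> i * \<delta> j)"

definition annealed_partition :: "real \<Rightarrow> real \<Rightarrow> real \<Rightarrow> real \<Rightarrow> nat \<Rightarrow> real" where
  "annealed_partition B \<kappa> \<beta> h n =
     measure_pmf.expectation (hier_pmf B n) (\<lambda>\<delta>. exp (annealed_hamiltonian \<kappa> \<beta> h n \<delta>))"

definition annealed_free_energy :: "real \<Rightarrow> real \<Rightarrow> real \<Rightarrow> real \<Rightarrow> real" where
  "annealed_free_energy B \<kappa> \<beta> h = lim (\<lambda>n. ln (annealed_partition B \<kappa> \<beta> h n) / 2 ^ n)"

definition annealed_critical_point :: "real \<Rightarrow> real \<Rightarrow> real \<Rightarrow> real" where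
  "annealed_critical_point B \<kappa> \<beta> = Sup {h. annealed_free_energy B \<kappa> \<beta> h = 0}"

end

theory Submission
  imports Defs
begin

text \<open>
  Splitting \<open>{1..2\<^bsup>n+1\<^esup>}\<close> into its halves turns the Hamiltonian into the sum of two independent copies and
  of the interaction \<open>\<beta>\<^sup>2 \<kappa>\<^bsup>n+1\<^esup> S S'\<close>. Without tilt, Cauchy-Schwarz over the four quarter interactions of
  two independent configurations doubles the coupling from scale \<open>n\<close> to scale \<open>n - 1\<close> and shows that the
  interaction costs at most \<open>exp (O(\<beta>\<^sup>2 r\<^sup>n) (|I| + |J|))\<close> with \<open>r < 1\<close>. As long as \<open>Z \<le> 1\<close>, expanding
  \<open>exp (u S S')\<close> in powers and using \<open>\<delta>\<^sub>i\<^sup>2 = \<delta>\<^sub>i\<close> transfers this to the tilted measure, which gives the upper bound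
  and \<open>Z\<^bsub>n+1\<^esub> \<le> 1 - 1 / B + (Z\<^sub>n\<^sup>2 + 8 \<beta>\<^sup>2 q\<^sup>n) / B\<close> with \<open>q = 4 \<kappa> / B\<^sup>2\<close>. The free energy vanishes exactly when
  \<open>Z\<^sub>n \<le> 1\<close> for all \<open>n\<close>. For \<open>h\<close> slightly above the critical point some \<open>Z\<^sub>m\<close> exceeds 1, and running the last
  recursion backwards from the first such \<open>m\<close> yields the lower bound on \<open>Z\<close> and, from it, the one for \<open>I \<noteq> {}\<close>.
\<close>

section \<open>The hierarchical structure\<close>

definition join_config :: "nat \<Rightarrow> (nat \<Rightarrow> real) \<Rightarrow> (nat \<Rightarrow> real) \<Rightarrow> nat \<Rightarrow> real" where
  "join_config n x y = (\<lambda>i. if i \<le> 2 ^ n then x i else y (i - 2 ^ n))"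

definition left_half :: "nat \<Rightarrow> nat set \<Rightarrow> nat set" where
  "left_half n I = {i \<in> I. i \<le> 2 ^ n}"

definition right_half :: "nat \<Rightarrow> nat set \<Rightarrow> nat set" where
  "right_half n I = (\<lambda>i. i - 2 ^ n) ` {i \<in> I. 2 ^ n < i}"

lemma left_half_subset: "I \<subseteq> {1..2 ^ Suc n} \<Longrightarrow> left_half n I \<subseteq> {1..2 ^ n}"
  by (auto simp: left_half_def)

lemma right_half_subset: "I \<subseteq> {1..2 ^ Suc n} \<Longrightarrow> right_half n I \<subseteq> {1..2 ^ n}"
  by (force simp: right_half_def)

lemma halves_empty [simp]: "left_half n {} = {}" "right_half n {} = {}"
  by (auto simp: left_half_def right_half_def)

lemma card_halves:
  assumes "finite I"
  shows "card I = card (left_half n I) + card (right_half n I)"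
proof -
  have "card (right_half n I) = card {i \<in> I. 2 ^ n < i}"
    unfolding right_half_def by (rule card_image) (auto simp: inj_on_def)
  moreover have "card I = card {i \<in> I. i \<le> 2 ^ n} + card {i \<in> I. 2 ^ n < i}"
    using assms by (subst card_Un_disjoint[symmetric]) (auto intro!: arg_cong[where f=card])
  ultimately show ?thesis by (simp add: left_half_def)
qed

lemma prod_join_config:
  assumes "finite I"
  shows "prod (join_config n x y) I = prod x (left_half n I) * prod y (right_half n I)"
proof -
  have "prod y (right_half n I) = (\<Prod>i\<in>{i \<in> I. 2 ^ n < i}. y (i - 2 ^ n))"
    unfolding right_half_def by (subst prod.reindex) (auto simp: inj_on_def)
  then have r: "prod y (right_half n I) = prod (join_config n x y) {i \<in> I. 2 ^ n < i}"
    by (auto simp: join_config_def)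
  have l: "prod x (left_half n I) = prod (join_config n x y) {i \<in> I. i \<le> 2 ^ n}"
    by (auto simp: join_config_def left_half_def)
  show ?thesis
    unfolding l r using assms
    by (subst prod.union_disjoint[symmetric]) (auto intro!: prod.cong)
qed

lemma sum_halves:
  fixes f :: "nat \<Rightarrow> 'a::comm_monoid_add"
  shows "(\<Sum>i = 1..2 ^ Suc n. f i) = (\<Sum>i = 1..2 ^ n. f i) + (\<Sum>i = 1..2 ^ n. f (i + 2 ^ n))"
proof -
  have "(\<Sum>i = 1..2 ^ Suc n. f i) = (\<Sum>i = 1..2 ^ n. f i) + (\<Sum>i = 2 ^ n + 1..2 ^ n + 2 ^ n. f i)"
    by (subst sum.ub_add_nat[symmetric]) (auto simp: mult_2)
  also have "(\<Sum>i = 2 ^ n + 1..2 ^ n + 2 ^ n. f i) = (\<Sum>i = 1..2 ^ n. f (i + 2 ^ n))"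
    using sum.shift_bounds_cl_nat_ivl[of f 1 "2 ^ n" "2 ^ n"] by (simp add: add.commute)
  finally show ?thesis .
qed

lemma num_contacts_join_config:
  "num_contacts (Suc n) (join_config n x y) = num_contacts n x + num_contacts n y"
  unfolding num_contacts_def sum_halves by (simp add: join_config_def)

text \<open>With sites counted from 0, the blocks of size 2^p are the fibres of division by 2^p, so
  the search for a common block becomes an equation between quotients.\<close>

lemma hier_dist_eq:
  assumes "1 \<le> i" "1 \<le> j"
  shows "hier_dist i j = (LEAST p. (i - 1) div 2 ^ p = (j - 1) div 2 ^ p)"
proof -
  have block: "i \<in> {(k - 1) * 2 ^ p + 1..k * 2 ^ p} \<longleftrightarrow> (i - 1) div 2 ^ p = k - 1"
    if pos: "1 \<le> k" "1 \<le> i" for i k p :: nat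
  proof -
    obtain l i' where ki: "k = Suc l" "i = Suc i'" using pos by (cases k; cases i) auto
    have "i' div 2 ^ p = l \<longleftrightarrow> l * 2 ^ p \<le> i' \<and> i' < Suc l * 2 ^ p"
      using dividend_less_div_times[of "2 ^ p" i'] div_times_less_eq_dividend[of i' "2 ^ p"]
      by (auto intro!: div_nat_eqI simp: mult.commute)
    then show ?thesis unfolding ki by auto
  qed
  have "(\<exists>k\<ge>1. i \<in> {(k - 1) * 2 ^ p + 1..k * 2 ^ p} \<and> j \<in> {(k - 1) * 2 ^ p + 1..k * 2 ^ p})
      \<longleftrightarrow> (i - 1) div 2 ^ p = (j - 1) div 2 ^ p" for p
  proof
    assume "(i - 1) div 2 ^ p = (j - 1) div 2 ^ p"
    then show "\<exists>k\<ge>1. i \<in> {(k - 1) * 2 ^ p + 1..k * 2 ^ p} \<and> j \<in> {(k - 1) * 2 ^ p + 1..k * 2 ^ p}"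
      using assms block[of "Suc ((i - 1) div 2 ^ p)" _ p]
      by (intro exI[of _ "Suc ((i - 1) div 2 ^ p)"] conjI) simp_all
  next
    assume "\<exists>k\<ge>1. i \<in> {(k - 1) * 2 ^ p + 1..k * 2 ^ p} \<and> j \<in> {(k - 1) * 2 ^ p + 1..k * 2 ^ p}"
    then show "(i - 1) div 2 ^ p = (j - 1) div 2 ^ p"
      using block[OF _ assms(1)] block[OF _ assms(2)] by metis
  qed
  then show ?thesis unfolding hier_dist_def by simp
qed

text \<open>For p \<le> n the shift is a multiple of 2^p and adds the same amount to both quotients;
  for p > n all four quotients are 0.\<close>

lemma hier_dist_shift:
  assumes "i \<in> {1..2 ^ n}" "j \<in> {1..2 ^ n}"
  shows "hier_dist (i + 2 ^ n) (j + 2 ^ n) = hier_dist i j"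
proof -
  have "(i - 1 + 2 ^ n) div 2 ^ p = (j - 1 + 2 ^ n) div 2 ^ p
    \<longleftrightarrow> (i - 1) div 2 ^ p = (j - 1) div 2 ^ p" for p
  proof (cases "p \<le> n")
    case True
    then have "(2::nat) ^ n = 2 ^ (n - p) * 2 ^ p" by (simp flip: power_add)
    then show ?thesis by simp
  next
    case False
    then have "(2::nat) ^ Suc n \<le> 2 ^ p" by (intro power_increasing) auto
    then have "i - 1 + 2 ^ n < 2 ^ p" "j - 1 + 2 ^ n < 2 ^ p" using assms by auto
    then show ?thesis by simp
  qed
  then show ?thesis using assms by (simp add: hier_dist_eq)
qed

text \<open>At scale n + 1 both sites lie in the first block. For p \<le> n the quotient of a left
  site is below 2^(n - p), that of a right site is not.\<close>

lemma hier_dist_cross: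
  assumes "i \<in> {1..2 ^ n}" "j \<in> {1..2 ^ n}"
  shows "hier_dist i (j + 2 ^ n) = Suc n" "hier_dist (j + 2 ^ n) i = Suc n"
proof -
  have "(LEAST p. (i - 1) div 2 ^ p = (j - 1 + 2 ^ n) div 2 ^ p) = Suc n"
  proof (rule Least_equality)
    have "i - 1 < 2 ^ Suc n" "j - 1 + 2 ^ n < 2 ^ Suc n" using assms by auto
    then show "(i - 1) div 2 ^ Suc n = (j - 1 + 2 ^ n) div 2 ^ Suc n"
      by (metis div_less)
  next
    fix p assume p: "(i - 1) div 2 ^ p = (j - 1 + 2 ^ n) div 2 ^ p"
    show "Suc n \<le> p"
    proof (rule ccontr)
      assume "\<not> Suc n \<le> p"
      then have n: "(2::nat) ^ n = 2 ^ (n - p) * 2 ^ p" by (simp flip: power_add)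
      have "(i - 1) div 2 ^ p < 2 ^ (n - p)"
        using assms n by (intro less_mult_imp_div_less) auto
      moreover have "2 ^ (n - p) \<le> (j - 1 + 2 ^ n) div 2 ^ p" by (subst n) simp
      ultimately show False using p by simp
    qed
  qed
  then show "hier_dist i (j + 2 ^ n) = Suc n" using assms by (simp add: hier_dist_eq)
  moreover have "hier_dist (j + 2 ^ n) i = hier_dist i (j + 2 ^ n)"
    unfolding hier_dist_def by (intro arg_cong[where f=Least] ext) auto
  ultimately show "hier_dist (j + 2 ^ n) i = Suc n" by simp
qed

text \<open>The distance is constant on the two mixed blocks of the double sum, so each of them
  factorises; being two, they cancel the 1/2 in front.\<close>

lemma annealed_hamiltonian_join_config:
  "annealed_hamiltonian \<kappa> \<beta> h (Suc n) (join_config n x y) =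
    annealed_hamiltonian \<kappa> \<beta> h n x + annealed_hamiltonian \<kappa> \<beta> h n y
    + \<beta>\<^sup>2 * \<kappa> ^ Suc n * (num_contacts n x * num_contacts n y)"
proof -
  let ?z = "join_config n x y"
  let ?f = "\<lambda>i j. \<kappa> ^ hier_dist i j * ?z i * ?z j"
  have zl: "?z i = x i" if "i \<in> {1..2 ^ n}" for i using that by (simp add: join_config_def)
  have zr: "?z (i + 2 ^ n) = y i" if "i \<in> {1..2 ^ n}" for i using that by (simp add: join_config_def)
  have "(\<Sum>i = 1..2 ^ n. \<Sum>j = 1..2 ^ n. ?f i j)
      = (\<Sum>i = 1..2 ^ n. \<Sum>j = 1..2 ^ n. \<kappa> ^ hier_dist i j * x i * x j)"
    by (intro sum.cong) (simp_all add: zl)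
  moreover have "(\<Sum>i = 1..2 ^ n. \<Sum>j = 1..2 ^ n. ?f (i + 2 ^ n) (j + 2 ^ n))
      = (\<Sum>i = 1..2 ^ n. \<Sum>j = 1..2 ^ n. \<kappa> ^ hier_dist i j * y i * y j)"
    by (intro sum.cong) (simp_all add: zr hier_dist_shift)
  moreover have "(\<Sum>i = 1..2 ^ n. \<Sum>j = 1..2 ^ n. ?f i (j + 2 ^ n))
      = (\<Sum>i = 1..2 ^ n. \<Sum>j = 1..2 ^ n. \<kappa> ^ Suc n * (x i * y j))"
    by (intro sum.cong) (simp_all add: zl zr hier_dist_cross)
  moreover have "(\<Sum>i = 1..2 ^ n. \<Sum>j = 1..2 ^ n. ?f (i + 2 ^ n) j)
      = (\<Sum>i = 1..2 ^ n. \<Sum>j = 1..2 ^ n. \<kappa> ^ Suc n * (y i * x j))"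
    by (intro sum.cong) (simp_all add: zl zr hier_dist_cross)
  moreover have "(\<Sum>i = 1..2 ^ n. \<Sum>j = 1..2 ^ n. \<kappa> ^ Suc n * (x i * y j))
      = \<kappa> ^ Suc n * (num_contacts n x * num_contacts n y)" for x y
    unfolding num_contacts_def sum_product by (simp only: sum_distrib_left)
  ultimately have "(\<Sum>i = 1..2 ^ Suc n. \<Sum>j = 1..2 ^ Suc n. ?f i j) =
      (\<Sum>i = 1..2 ^ n. \<Sum>j = 1..2 ^ n. \<kappa> ^ hier_dist i j * x i * x j)
      + (\<Sum>i = 1..2 ^ n. \<Sum>j = 1..2 ^ n. \<kappa> ^ hier_dist i j * y i * y j)
      + 2 * (\<kappa> ^ Suc n * (num_contacts n x * num_contacts n y))"
    unfolding sum_halves sum.distrib by simp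
  then show ?thesis
    unfolding annealed_hamiltonian_def num_contacts_join_config by (simp add: algebra_simps)
qed

section \<open>Configurations, finite expectations and their recursion\<close>

lemma finite_config [simp]: "finite (set_pmf (hier_pmf B n))"
  by (induction n) auto

lemma integrable_hier_pmf [simp]:
  "integrable (measure_pmf (hier_pmf B n)) (f :: (nat \<Rightarrow> real) \<Rightarrow> real)"
  by (simp add: integrable_measure_pmf_finite)

lemma config_values:
  assumes "x \<in> set_pmf (hier_pmf B n)"
  shows "x i = 0 \<or> x i = 1"
  using set_hier_pmf[of B n] assms by (fastforce simp: PiE_dflt_def)

lemma config_nonneg: "x \<in> set_pmf (hier_pmf B n) \<Longrightarrow> 0 \<le> x i"
  using config_values[of x B n i] by auto

lemma prod_config_nonneg: "x \<in> set_pmf (hier_pmf B n) \<Longrightarrow> 0 \<le> prod x I"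
  by (simp add: prod_nonneg config_nonneg)

lemma num_contacts_nonneg: "x \<in> set_pmf (hier_pmf B n) \<Longrightarrow> 0 \<le> num_contacts n x"
  unfolding num_contacts_def by (intro sum_nonneg config_nonneg)

lemma num_contacts_le: "x \<in> set_pmf (hier_pmf B n) \<Longrightarrow> num_contacts n x \<le> 2 ^ n"
proof -
  assume x: "x \<in> set_pmf (hier_pmf B n)"
  have "num_contacts n x \<le> (\<Sum>i = 1..(2::nat) ^ n. 1)"
    unfolding num_contacts_def
  proof (rule sum_mono)
    show "x i \<le> 1" for i using config_values[OF x, of i] by auto
  qed
  then show ?thesis by simp
qed

lemma set_hier_pmf_Suc:
  assumes "z \<in> set_pmf (hier_pmf B (Suc n))"
  obtains "z = (\<lambda>_. 0)"
  | x y where "x \<in> set_pmf (hier_pmf B n)" "y \<in> set_pmf (hier_pmf B n)" "z = join_config n x y"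
  using assms by (auto simp: join_config_def split: if_splits)

declare hier_pmf.simps(2) [simp del]

lemma expectation_pair_pmf:
  fixes f :: "'a \<times> 'b \<Rightarrow> real"
  assumes "finite (set_pmf p)" "finite (set_pmf q)"
  shows "measure_pmf.expectation (pair_pmf p q) f =
    measure_pmf.expectation p (\<lambda>x. measure_pmf.expectation q (\<lambda>y. f (x, y)))"
proof -
  have "measure_pmf.expectation (pair_pmf p q) f =
      (\<Sum>z\<in>set_pmf p \<times> set_pmf q. pmf (pair_pmf p q) z * f z)"
    using assms by (subst integral_measure_pmf[where A = "set_pmf p \<times> set_pmf q"]) auto
  also have "\<dots> = (\<Sum>x\<in>set_pmf p. pmf p x * (\<Sum>y\<in>set_pmf q. pmf q y * f (x, y)))"
    by (simp add: sum.cartesian_product' pmf_pair sum_distrib_left mult.assoc)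
  also have "\<dots> = measure_pmf.expectation p (\<lambda>x. \<Sum>y\<in>set_pmf q. pmf q y * f (x, y))"
    using assms by (subst integral_measure_pmf[where A = "set_pmf p"]) auto
  also have "(\<lambda>x. \<Sum>y\<in>set_pmf q. pmf q y * f (x, y)) =
      (\<lambda>x. measure_pmf.expectation q (\<lambda>y. f (x, y)))"
    using assms by (intro ext, subst integral_measure_pmf[where A = "set_pmf q"]) auto
  finally show ?thesis .
qed

locale hier_pinning =
  fixes B \<kappa> :: real
  assumes B: "1 < B" "B < 2"
    and \<kappa>: "0 < \<kappa>" "4 * \<kappa> < B\<^sup>2" "2 * \<kappa> < 1"
begin

abbreviation E :: "nat \<Rightarrow> ((nat \<Rightarrow> real) \<Rightarrow> real) \<Rightarrow> real" where
  "E n f \<equiv> measure_pmf.expectation (hier_pmf B n) f"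

abbreviation configs :: "nat \<Rightarrow> (nat \<Rightarrow> real) set" where
  "configs n \<equiv> set_pmf (hier_pmf B n)"

abbreviation S :: "nat \<Rightarrow> (nat \<Rightarrow> real) \<Rightarrow> real" where
  "S \<equiv> num_contacts"

lemma E_eq_sum: "E n f = (\<Sum>x\<in>configs n. pmf (hier_pmf B n) x * f x)"
  by (subst integral_measure_pmf[where A = "configs n"]) auto

lemma E_mono: "(\<And>x. x \<in> configs n \<Longrightarrow> f x \<le> g x) \<Longrightarrow> E n f \<le> E n g"
  unfolding E_eq_sum by (intro sum_mono mult_left_mono) auto

lemma E_cong: "(\<And>x. x \<in> configs n \<Longrightarrow> f x = g x) \<Longrightarrow> E n f = E n g"
  unfolding E_eq_sum by (intro sum.cong) auto

lemma E_nonneg: "(\<And>x. x \<in> configs n \<Longrightarrow> 0 \<le> f x) \<Longrightarrow> 0 \<le> E n f"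
  using E_mono[of n "\<lambda>_. 0" f] by simp

lemma E_sum: "E n (\<lambda>x. \<Sum>i\<in>A. f i x) = (\<Sum>i\<in>A. E n (f i))"
  by (rule Bochner_Integration.integral_sum) simp

lemma E_swap: "E n (\<lambda>x. E n (\<lambda>y. f x y)) = E n (\<lambda>y. E n (\<lambda>x. f x y))"
  unfolding E_eq_sum sum_distrib_left by (subst sum.swap) (simp add: mult.left_commute)

lemma E_sums:
  assumes "\<And>x. (\<lambda>k. f k x) sums g x"
  shows "(\<lambda>k. E n (f k)) sums E n g"
  unfolding E_eq_sum by (intro sums_sum sums_mult assms)

lemma E_Suc:
  "E (Suc n) f = (1 - 1 / B) * f (\<lambda>_. 0) + 1 / B * E n (\<lambda>x. E n (\<lambda>y. f (join_config n x y)))"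
proof -
  have "E (Suc n) f = (\<Sum>b\<in>UNIV. pmf (bernoulli_pmf (1 / B)) b *\<^sub>R measure_pmf.expectation
      (if b then map_pmf (\<lambda>(x, y) i. if i \<le> 2 ^ n then x i else y (i - 2 ^ n))
         (pair_pmf (hier_pmf B n) (hier_pmf B n)) else return_pmf (\<lambda>_. 0)) f)"
    unfolding hier_pmf.simps by (rule pmf_expectation_bind) auto
  also have "\<dots> = (1 - 1 / B) * f (\<lambda>_. 0) + 1 / B * E n (\<lambda>x. E n (\<lambda>y. f (join_config n x y)))"
    using B by (simp add: UNIV_bool expectation_pair_pmf join_config_def)
  finally show ?thesis .
qed

lemma E_prod_Suc:
  assumes "I \<noteq> {}" "finite I"
  shows "E (Suc n) (\<lambda>x. prod x I) = 1 / B * (E n (\<lambda>x. prod x (left_half n I)) * E n (\<lambda>x. prod x (right_half n I)))"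
proof -
  have "(\<Prod>i\<in>I. (0::real)) = 0" using assms by (simp add: card_gt_0_iff)
  then show ?thesis using assms by (simp add: E_Suc prod_join_config)
qed

lemma E_prod_nonneg: "0 \<le> E n (\<lambda>x. prod x I)"
  by (intro E_nonneg prod_config_nonneg)

lemma prod_insert_config:
  assumes "x \<in> configs n" "finite I"
  shows "prod x (insert i I) = prod x I * x i"
proof (cases "i \<in> I")
  case True
  then show ?thesis
    using assms config_values[OF assms(1), of i] by (cases "x i = 0") (auto simp: insert_absorb prod_zero_iff)
qed (use assms in auto)

text \<open>Since \<open>\<delta>\<^sub>i\<^sup>2 = \<delta>\<^sub>i\<close>, the weights \<open>\<delta>\<^sub>I S\<^sup>k\<close> are nonnegative combinations of \<open>\<delta>\<^sub>J\<close> with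
  \<open>|J| \<le> |I| + k\<close>.\<close>

lemma E_prod_power_le:
  assumes bound: "\<And>I. I \<subseteq> {1..2 ^ n} \<Longrightarrow>
      E n (\<lambda>x. prod x I * f x) \<le> exp (c * real (card I)) * E n (\<lambda>x. prod x I)"
    and c: "0 \<le> c" and I: "I \<subseteq> {1..2 ^ n}"
  shows "E n (\<lambda>x. prod x I * S n x ^ k * f x)
      \<le> exp (c * real (card I + k)) * E n (\<lambda>x. prod x I * S n x ^ k)"
  using I
proof (induction k arbitrary: I)
  case 0
  then show ?case using bound by simp
next
  case (Suc k)
  have fin: "finite I" using Suc.prems by (rule finite_subset) simp
  have expand: "E n (\<lambda>x. prod x I * S n x ^ Suc k * g x)
      = (\<Sum>i = 1..2 ^ n. E n (\<lambda>x. prod x (insert i I) * S n x ^ k * g x))" for g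
  proof -
    have "E n (\<lambda>x. prod x I * S n x ^ Suc k * g x)
        = E n (\<lambda>x. \<Sum>i = 1..2 ^ n. prod x (insert i I) * S n x ^ k * g x)"
    proof (rule E_cong)
      fix x assume "x \<in> configs n"
      then have "(\<Sum>i = 1..2 ^ n. prod x (insert i I) * S n x ^ k * g x)
          = (\<Sum>i = 1..2 ^ n. x i * (prod x I * S n x ^ k * g x))"
        using fin by (intro sum.cong) (simp_all add: prod_insert_config)
      also have "\<dots> = S n x * (prod x I * S n x ^ k * g x)"
        unfolding sum_distrib_right[symmetric] by (simp add: num_contacts_def)
      finally show "prod x I * S n x ^ Suc k * g x = (\<Sum>i = 1..2 ^ n. prod x (insert i I) * S n x ^ k * g x)"
        by simp
    qed
    then show ?thesis by (simp add: E_sum)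
  qed
  have "E n (\<lambda>x. prod x (insert i I) * S n x ^ k * f x)
      \<le> exp (c * real (card I + Suc k)) * E n (\<lambda>x. prod x (insert i I) * S n x ^ k)"
    if i: "i \<in> {1..2 ^ n}" for i
  proof -
    have "E n (\<lambda>x. prod x (insert i I) * S n x ^ k * f x)
      \<le> exp (c * real (card (insert i I) + k)) * E n (\<lambda>x. prod x (insert i I) * S n x ^ k)"
      using Suc i by (intro Suc.IH) auto
    \<comment> \<open>If \<open>i\<close> already lies in \<open>I\<close> the set does not grow;
      the larger exponent is still a bound because c \<ge> 0.\<close>
    also have "\<dots> \<le> exp (c * real (card I + Suc k)) * E n (\<lambda>x. prod x (insert i I) * S n x ^ k)"
      using c fin card_insert_le_m1[of "Suc (card I)" I i]
      by (intro mult_right_mono E_nonneg mult_nonneg_nonneg prod_config_nonneg zero_le_power num_contacts_nonneg)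
         (auto intro!: mult_left_mono simp: card_insert_if)
    finally show ?thesis .
  qed
  then have "E n (\<lambda>x. prod x I * S n x ^ Suc k * f x)
      \<le> (\<Sum>i = 1..2 ^ n. exp (c * real (card I + Suc k)) * E n (\<lambda>x. prod x (insert i I) * S n x ^ k))"
    unfolding expand by (intro sum_mono)
  also have "\<dots> = exp (c * real (card I + Suc k)) * E n (\<lambda>x. prod x I * S n x ^ Suc k)"
    using expand[of "\<lambda>_. 1"] by (simp add: sum_distrib_left)
  finally show ?case .
qed

section \<open>Interaction of two independent configurations\<close>

abbreviation p :: "nat \<Rightarrow> nat set \<Rightarrow> real" where
  "p n I \<equiv> E n (\<lambda>x. prod x I)"

definition pair_weight :: "nat \<Rightarrow> real \<Rightarrow> nat set \<Rightarrow> nat set \<Rightarrow> real" where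
  "pair_weight n v I J = E n (\<lambda>x. E n (\<lambda>y. prod x I * prod y J * exp (v * (S n x * S n y))))"

text \<open>The part of \<open>pair_weight\<close> at scale n + 1 where neither copy is killed:
  \<open>x\<close>, \<open>x'\<close> are the halves of the first copy, \<open>y\<close>,
  \<open>y'\<close> those of the second.\<close>

definition quad_weight ::
    "nat \<Rightarrow> real \<Rightarrow> nat set \<Rightarrow> nat set \<Rightarrow> nat set \<Rightarrow> nat set \<Rightarrow> real" where
  "quad_weight n v I I' J J' = E n (\<lambda>x. E n (\<lambda>x'. E n (\<lambda>y. E n (\<lambda>y'.
     prod x I * prod x' I' * (prod y J * prod y' J') * exp (v * ((S n x + S n x') * (S n y + S n y')))))))"

lemma pair_weight_commute: "pair_weight n v I J = pair_weight n v J I"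
  unfolding pair_weight_def by (subst E_swap) (simp add: mult.commute)

text \<open>The cases are: both copies killed, only the first, only the second, none. A killed copy
  is the zero configuration; it switches the interaction off and contributes only if nothing is
  pinned on it.\<close>

lemma pair_weight_Suc:
  assumes "finite I" "finite J"
  shows "pair_weight (Suc n) v I J =
    (1 - 1 / B) * (1 - 1 / B) * (if I = {} \<and> J = {} then 1 else 0)
    + (1 - 1 / B) * (1 / B) * (if I = {} then p n (left_half n J) * p n (right_half n J) else 0)
    + (1 - 1 / B) * (1 / B) * (if J = {} then p n (left_half n I) * p n (right_half n I) else 0)
    + quad_weight n v (left_half n I) (right_half n I) (left_half n J) (right_half n J) / B\<^sup>2"
proof -
  have S0: "S m (\<lambda>_. 0) = 0" for m by (simp add: num_contacts_def)
  show ?thesis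
    unfolding pair_weight_def E_Suc quad_weight_def
    using assms
    by (simp add: power_0_left card_eq_0_iff S0 prod_join_config num_contacts_join_config
        power2_eq_square distrib_left mult.assoc mult.left_commute)
qed

text \<open>The four interactions are grouped as \<open>(xy + x'y') + (xy' + x'y)\<close>, and each group is a
  sum over independent pairs. The weights \<open>exp (\<plusminus>\<theta>)\<close> turn the arithmetic into the geometric mean.\<close>

lemma quad_weight_le:
  assumes "pair_weight n (2 * v) I J \<le> p n I * p n J * exp a"
    and "pair_weight n (2 * v) I' J' \<le> p n I' * p n J' * exp b"
    and "pair_weight n (2 * v) I J' \<le> p n I * p n J' * exp c"
    and "pair_weight n (2 * v) I' J \<le> p n I' * p n J * exp d"
  shows "quad_weight n v I I' J J' \<le> p n I * p n I' * (p n J * p n J') * exp ((a + b + c + d) / 2)"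
proof -
  \<comment> \<open>This choice makes exp (\<theta> + a + b) and exp (- \<theta> + c + d) equal,
    both being the exponential of (a + b + c + d) / 2.\<close>
  define \<theta> where "\<theta> = (c + d - (a + b)) / 2"
  define P where "P = p n I * p n I' * (p n J * p n J')"
  let ?w = "\<lambda>I J x y. prod x I * prod y J * exp (2 * v * (S n x * S n y))"
  let ?E4 = "\<lambda>f. E n (\<lambda>x. E n (\<lambda>x'. E n (\<lambda>y. E n (\<lambda>y'. f x x' y y'))))"
  have amgm: "exp (s + t) \<le> exp \<theta> / 2 * exp (2 * s) + exp (- \<theta>) / 2 * exp (2 * t)" for s t :: real
  proof -
    have "0 \<le> (exp (\<theta> / 2 + s) - exp (- \<theta> / 2 + t))\<^sup>2" by simp
    also have "\<dots> = exp \<theta> * exp (2 * s) + exp (- \<theta>) * exp (2 * t) - 2 * exp (s + t)"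
      by (simp add: power2_eq_square algebra_simps flip: exp_add)
    finally show ?thesis by simp
  qed
  have nonneg: "0 \<le> pair_weight n (2 * v) I J" for I J
    unfolding pair_weight_def
    by (intro E_nonneg mult_nonneg_nonneg prod_config_nonneg) (auto intro: less_imp_le)
  have "quad_weight n v I I' J J' \<le>
      ?E4 (\<lambda>x x' y y'. exp \<theta> / 2 * (?w I J x y * ?w I' J' x' y') + exp (- \<theta>) / 2 * (?w I J' x y' * ?w I' J x' y))"
    unfolding quad_weight_def
  proof (intro E_mono)
    fix x x' y y' assume x: "x \<in> configs n" "x' \<in> configs n" "y \<in> configs n" "y' \<in> configs n"
    let ?q = "prod x I * prod x' I' * (prod y J * prod y' J')"
    have q: "0 \<le> ?q" using x by (simp add: prod_config_nonneg)
    have "?q * exp (v * ((S n x + S n x') * (S n y + S n y')))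
      = ?q * exp (v * (S n x * S n y + S n x' * S n y') + v * (S n x * S n y' + S n x' * S n y))"
      by (simp add: algebra_simps)
    also have "\<dots> \<le> ?q * (exp \<theta> / 2 * exp (2 * (v * (S n x * S n y + S n x' * S n y')))
        + exp (- \<theta>) / 2 * exp (2 * (v * (S n x * S n y' + S n x' * S n y))))"
      using q by (intro mult_left_mono amgm)
    also have "\<dots> = exp \<theta> / 2 * (?w I J x y * ?w I' J' x' y') + exp (- \<theta>) / 2 * (?w I J' x y' * ?w I' J x' y)"
      by (simp add: distrib_left exp_add mult_ac)
    finally show "?q * exp (v * ((S n x + S n x') * (S n y + S n y'))) \<le>
      exp \<theta> / 2 * (?w I J x y * ?w I' J' x' y') + exp (- \<theta>) / 2 * (?w I J' x y' * ?w I' J x' y)" .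
  qed
  also have "\<dots> = exp \<theta> / 2 * ?E4 (\<lambda>x x' y y'. ?w I J x y * ?w I' J' x' y')
      + exp (- \<theta>) / 2 * ?E4 (\<lambda>x x' y y'. ?w I J' x y' * ?w I' J x' y)"
    by simp
  also have "?E4 (\<lambda>x x' y y'. ?w I J x y * ?w I' J' x' y')
      = pair_weight n (2 * v) I J * pair_weight n (2 * v) I' J'"
  proof -
    have "?E4 (\<lambda>x x' y y'. ?w I J x y * ?w I' J' x' y')
      = E n (\<lambda>x. E n (\<lambda>y. E n (\<lambda>x'. E n (\<lambda>y'. ?w I J x y * ?w I' J' x' y'))))"
      by (rule E_cong, rule E_swap)
    then show ?thesis unfolding pair_weight_def by simp
  qed
  also have "?E4 (\<lambda>x x' y y'. ?w I J' x y' * ?w I' J x' y)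
      = pair_weight n (2 * v) I J' * pair_weight n (2 * v) I' J"
  proof -
    have "?E4 (\<lambda>x x' y y'. ?w I J' x y' * ?w I' J x' y)
      = E n (\<lambda>x. E n (\<lambda>x'. E n (\<lambda>y'. E n (\<lambda>y. ?w I J' x y' * ?w I' J x' y))))"
      by (rule E_cong, rule E_cong, rule E_swap)
    also have "\<dots> = E n (\<lambda>x. E n (\<lambda>y'. E n (\<lambda>x'. E n (\<lambda>y. ?w I J' x y' * ?w I' J x' y))))"
      by (rule E_cong, rule E_swap)
    finally show ?thesis unfolding pair_weight_def by simp
  qed
  also have "exp \<theta> / 2 * (pair_weight n (2 * v) I J * pair_weight n (2 * v) I' J')
      + exp (- \<theta>) / 2 * (pair_weight n (2 * v) I J' * pair_weight n (2 * v) I' J)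
    \<le> exp \<theta> / 2 * ((p n I * p n J * exp a) * (p n I' * p n J' * exp b))
      + exp (- \<theta>) / 2 * ((p n I * p n J' * exp c) * (p n I' * p n J * exp d))"
    using assms by (intro add_mono mult_left_mono mult_mono nonneg) (auto intro!: mult_nonneg_nonneg E_prod_nonneg)
  also have "\<dots> = P * (exp \<theta> * (exp a * exp b) + exp (- \<theta>) * (exp c * exp d)) / 2"
    by (simp add: P_def algebra_simps)
  also have "exp \<theta> * (exp a * exp b) = exp ((a + b + c + d) / 2)"
    by (simp add: \<theta>_def field_simps flip: exp_add)
  also have "exp (- \<theta>) * (exp c * exp d) = exp ((a + b + c + d) / 2)"
    by (simp add: \<theta>_def field_simps flip: exp_add)
  finally show ?thesis by (simp add: P_def)
qed

text \<open>For empty sets the four bounds in \<open>quad_weight_le\<close> coincide and give g^2.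
  Both copies survive with probability 1 / B^2, and otherwise the weight is 1, so the excess over 1
  is divided by B^2.\<close>

lemma pair_weight_empty_Suc:
  "pair_weight (Suc n) v {} {} - 1 \<le> ((pair_weight n (2 * v) {} {})\<^sup>2 - 1) / B\<^sup>2"
proof -
  define g where "g = pair_weight n (2 * v) {} {}"
  \<comment> \<open>Positivity allows the exponents \<open>ln g\<close> below. As \<open>v\<close>
    may have either sign, the crude bound S \<le> 2^n is used.\<close>
  have g: "0 < g"
  proof -
    have "0 < exp (- \<bar>2 * v\<bar> * (2 ^ n * 2 ^ n))" by simp
    also have "exp (- \<bar>2 * v\<bar> * (2 ^ n * 2 ^ n)) = E n (\<lambda>x. E n (\<lambda>y. exp (- \<bar>2 * v\<bar> * (2 ^ n * 2 ^ n))))"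
      by simp
    also have "\<dots> \<le> g" unfolding g_def pair_weight_def
    proof (intro E_mono)
      fix x y assume "x \<in> configs n" "y \<in> configs n"
      then have s: "0 \<le> S n x * S n y" "S n x * S n y \<le> 2 ^ n * 2 ^ n"
        by (auto intro!: mult_mono num_contacts_le num_contacts_nonneg mult_nonneg_nonneg)
      have "- (\<bar>2 * v\<bar> * (2 ^ n * 2 ^ n)) \<le> - (\<bar>2 * v\<bar> * (S n x * S n y))"
        using s(2) by (intro le_imp_neg_le mult_left_mono) auto
      also have "\<dots> = (- \<bar>2 * v\<bar>) * (S n x * S n y)" by simp
      also have "\<dots> \<le> 2 * v * (S n x * S n y)" using s(1) by (intro mult_right_mono) auto
      finally show "exp (- \<bar>2 * v\<bar> * (2 ^ n * 2 ^ n)) \<le> prod x {} * prod y {} * exp (2 * v * (S n x * S n y))"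
        by simp
    qed
    finally show ?thesis .
  qed
  have "exp ((ln g + ln g + ln g + ln g) / 2) = g\<^sup>2"
    using g by (simp add: exp_double)
  then have "quad_weight n v {} {} {} {} \<le> g\<^sup>2"
    using quad_weight_le[of n v "{}" "{}" "ln g" "{}" "{}" "ln g" "ln g" "ln g"] g
    by (simp add: g_def[symmetric])
  then have "pair_weight (Suc n) v {} {} \<le> (1 - 1 / B) * (1 - 1 / B) + 2 * ((1 - 1 / B) * (1 / B)) + g\<^sup>2 / B\<^sup>2"
    using B by (simp add: pair_weight_Suc divide_right_mono)
  also have "\<dots> = 1 + (g\<^sup>2 - 1) / B\<^sup>2"
    using B by (simp add: field_simps power2_eq_square)
  finally show ?thesis by (simp add: g_def)
qed

end

text \<open>Exponents for the pairs \<open>(I, J)\<close> of sizes \<open>i\<close> and \<open>j\<close>: a pair of empty sets has a fixed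
  cost \<open>M\<close>, which cannot be charged to the sites of \<open>I\<close> and \<open>J\<close>.\<close>

definition pair_cost :: "real \<Rightarrow> real \<Rightarrow> nat \<Rightarrow> nat \<Rightarrow> real" where
  "pair_cost M b i j =
     (if i = 0 \<and> j = 0 then M
      else if i = 0 \<or> j = 0 then b * real (i + j) else (b + M / 2) * real (i + j))"

lemma pair_cost_le:
  assumes "0 \<le> M" "i \<noteq> 0 \<or> j \<noteq> 0"
  shows "pair_cost M b i j \<le> (b + M / 2) * real (i + j)"
  using assms by (auto simp: pair_cost_def intro!: mult_right_mono)

text \<open>At most one of the four pairs is empty. If none is, every index occurs in two pairs and
  \<open>pair_cost_le\<close> suffices. If one is, the opposite pair has k, l \<ge> 1, and its share
  M / 2 per site, halved on the left, leaves room for M / 2 because k + l \<ge> 2.\<close>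

lemma pair_cost_split:
  assumes M: "0 \<le> M" and pos: "i + i' \<noteq> 0" "j + j' \<noteq> 0"
  shows "(pair_cost M b i j + pair_cost M b i' j' + pair_cost M b i j' + pair_cost M b i' j) / 2
    \<le> pair_cost M b (i + i') (j + j')"
proof -
  have diag: "(pair_cost M b k l + M + pair_cost M b k 0 + pair_cost M b 0 l) / 2 \<le> (b + M / 2) * real (k + l)"
    if "k \<noteq> 0" "l \<noteq> 0" for k l
  proof -
    have "M * 2 \<le> M * real (k + l)" using M that by (intro mult_left_mono) auto
    then show ?thesis using that by (simp add: pair_cost_def field_simps)
  qed
  have zero: "pair_cost M b 0 0 = M" by (simp add: pair_cost_def)
  have rhs: "pair_cost M b (i + i') (j + j') = (b + M / 2) * real (i + i' + (j + j'))"
    using pos unfolding pair_cost_def by (simp only: if_False add_is_0 simp_thms)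
  consider "i = 0 \<and> j = 0" | "i' = 0 \<and> j' = 0" | "i = 0 \<and> j' = 0" | "i' = 0 \<and> j = 0"
    | "i \<noteq> 0 \<or> j \<noteq> 0" "i' \<noteq> 0 \<or> j' \<noteq> 0" "i \<noteq> 0 \<or> j' \<noteq> 0" "i' \<noteq> 0 \<or> j \<noteq> 0"
    by blast
  then show ?thesis
  proof cases
    case 1
    then show ?thesis unfolding rhs using diag[of i' j'] pos zero by (simp add: ac_simps)
  next
    case 2
    then show ?thesis unfolding rhs using diag[of i j] pos zero by (simp add: ac_simps)
  next
    case 3
    then show ?thesis unfolding rhs using diag[of i' j] pos zero by (simp add: ac_simps)
  next
    case 4
    then show ?thesis unfolding rhs using diag[of i j'] pos zero by (simp add: ac_simps)
  next
    case 5
    define a where "a = b + M / 2"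
    note le = 5[THEN pair_cost_le[OF M, of _ _ b], folded a_def]
    show ?thesis unfolding rhs a_def[symmetric] using le by (simp add: algebra_simps)
  qed
qed

context hier_pinning
begin

section \<open>Bounds on the pair weights by recursion over the scales\<close>

lemma pair_weight_empty_ge:
  assumes "0 \<le> v"
  shows "1 \<le> pair_weight n v {} {}"
proof -
  have "E n (\<lambda>x. E n (\<lambda>y. 1)) \<le> pair_weight n v {} {}"
    unfolding pair_weight_def using assms
    by (intro E_mono) (simp add: num_contacts_nonneg)
  then show ?thesis by simp
qed

text \<open>The recursion \<open>x\<^bsub>k+1\<^esub> \<le> \<rho> x\<^sub>k (1 + x\<^sub>k / 2)\<close> with \<open>\<rho> = 2 / B\<^sup>2\<close> is linear up to the factors
  \<open>1 + x\<^sub>k / 2 \<le> exp (x\<^sub>k / 2)\<close>, whose product stays bounded.\<close>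

lemma pair_weight_empty_le:
  defines "\<rho> \<equiv> 2 / B\<^sup>2"
  assumes w: "0 \<le> w" "w \<le> 1" and sum: "2 * w * (\<Sum>j<n. \<rho> ^ j) \<le> 1 / 2"
    and k: "k \<le> n"
  shows "pair_weight k (w / 2 ^ k) {} {} - 1 \<le> 4 * w * \<rho> ^ k"
proof -
  \<comment> \<open>The coupling halves with each scale gained, matching the doubling in
    \<open>pair_weight_empty_Suc\<close>.\<close>
  define x where "x k = pair_weight k (w / 2 ^ k) {} {} - 1" for k
  have \<rho>: "0 < \<rho>" using B by (simp add: \<rho>_def)
  have x0: "0 \<le> x k" for k
    using pair_weight_empty_ge[of "w / 2 ^ k" k] w by (simp add: x_def)
  have half: "exp (1 / 2 :: real) \<le> 2"
    using exp_bound[of "1 / 2 :: real"] by (simp add: power2_eq_square)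
  \<comment> \<open>The accumulated exponent is at most 1/2, hence its exponential at most 2. The
    induction for \<open>strong\<close> feeds this weaker form back into the factor 1 + x k /
    2.\<close>
  have weak: "x k \<le> 4 * w * \<rho> ^ k"
    if "x k \<le> 2 * w * \<rho> ^ k * exp (2 * w * (\<Sum>j<k. \<rho> ^ j))" "k \<le> n" for k
  proof -
    have "2 * w * (\<Sum>j<k. \<rho> ^ j) \<le> 2 * w * (\<Sum>j<n. \<rho> ^ j)"
      using \<rho> w that by (intro mult_left_mono sum_mono2) auto
    then have "2 * w * (\<Sum>j<k. \<rho> ^ j) \<le> 1 / 2" using sum by linarith
    then have "exp (2 * w * (\<Sum>j<k. \<rho> ^ j)) \<le> 2"
      using half by (meson exp_le_cancel_iff order_trans)
    then have "2 * w * \<rho> ^ k * exp (2 * w * (\<Sum>j<k. \<rho> ^ j)) \<le> 2 * w * \<rho> ^ k * 2"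
      using w \<rho> by (intro mult_left_mono) auto
    then show ?thesis using that by simp
  qed
  have strong: "x k \<le> 2 * w * \<rho> ^ k * exp (2 * w * (\<Sum>j<k. \<rho> ^ j))" if "k \<le> n" for k
    using that
  proof (induction k)
    case 0
    have "exp w \<le> 1 + 2 * w"
      using exp_bound[of w] w mult_left_le[of w w] by (simp add: power2_eq_square)
    moreover have "x 0 = exp w - 1" by (simp add: x_def pair_weight_def num_contacts_def)
    ultimately show ?case by simp
  next
    case (Suc k)
    then have IH: "x k \<le> 2 * w * \<rho> ^ k * exp (2 * w * (\<Sum>j<k. \<rho> ^ j))" by simp
    then have xk: "x k \<le> 4 * w * \<rho> ^ k" using weak Suc by simp
    have "x (Suc k) \<le> ((1 + x k)\<^sup>2 - 1) / B\<^sup>2"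
      using pair_weight_empty_Suc[of k "w / 2 ^ Suc k"] by (simp add: x_def)
    also have "\<dots> = \<rho> * x k * (1 + x k / 2)"
      using B by (simp add: \<rho>_def field_simps power2_eq_square)
    also have "\<dots> \<le> \<rho> * x k * exp (2 * w * \<rho> ^ k)"
    proof (intro mult_left_mono)
      show "1 + x k / 2 \<le> exp (2 * w * \<rho> ^ k)"
        using xk exp_ge_add_one_self[of "2 * w * \<rho> ^ k"] by linarith
    qed (use \<rho> x0[of k] in simp)
    also have "\<dots> \<le> \<rho> * (2 * w * \<rho> ^ k * exp (2 * w * (\<Sum>j<k. \<rho> ^ j))) * exp (2 * w * \<rho> ^ k)"
      using IH \<rho> by (intro mult_right_mono mult_left_mono) auto
    also have "\<dots> = 2 * w * \<rho> ^ Suc k * exp (2 * w * (\<Sum>j<Suc k. \<rho> ^ j))"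
      by (simp add: distrib_left exp_add)
    finally show ?case .
  qed
  show ?thesis using weak[OF strong[OF k] k] by (simp add: x_def)
qed

text \<open>An empty block is killed with probability \<open>1 - 1 / B\<close>; this absorbs the cost \<open>M\<close>.\<close>

lemma killing_absorbs_cost:
  assumes M: "0 \<le> M" "M \<le> 1" "4 * M \<le> B - 1" and y: "4 * M / (B - 1) \<le> y"
  shows "1 - 1 / B + exp (y + M) / B \<le> exp y"
proof -
  \<comment> \<open>The gain b (B - 1) = 4 M pays 2 M for exp M \<le> 1 + 2 M and at most 2 M for
    the cross term 2 M b.\<close>
  define b where "b = 4 * M / (B - 1)"
  have b: "0 \<le> b" "b * (B - 1) = 4 * M" using B M by (simp_all add: b_def)
  have eM: "exp M \<le> 1 + 2 * M"
    using exp_bound[of M] M mult_left_le[of M M] by (simp add: power2_eq_square)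
  have "b * (2 * M) \<le> b * ((B - 1) / 2)" using M b by (intro mult_left_mono) auto
  then have "B - 1 \<le> (1 + b) * (B - 1 - 2 * M)" using b by (simp add: algebra_simps)
  also have "\<dots> \<le> exp y * (B - exp M)"
  proof (rule mult_mono)
    show "1 + b \<le> exp y" using exp_ge_add_one_self[of y] y unfolding b_def by linarith
  qed (use eM M in auto)
  finally have "(B - 1 + exp (y + M)) / B \<le> exp y"
    using B by (simp add: divide_le_eq exp_add algebra_simps)
  also have "(B - 1 + exp (y + M)) / B = 1 - 1 / B + exp (y + M) / B"
    using B by (simp add: field_simps)
  finally show ?thesis .
qed

text \<open>Induction on the scale. The empty pair is the hypothesis \<open>empty\<close>. If one
  set is empty, the chance that its copy is killed absorbs M. If both are nonempty, both copies must
  survive and \<open>pair_cost_split\<close> applies.\<close>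

lemma pair_weight_le:
  assumes w: "0 \<le> w" "w \<le> M" and M: "M \<le> 1" "4 * M \<le> B - 1"
    and empty: "\<And>k. k \<le> n \<Longrightarrow> pair_weight k (w / 2 ^ k) {} {} \<le> exp M"
    and k: "k \<le> n" and I: "I \<subseteq> {1..2 ^ k}" and J: "J \<subseteq> {1..2 ^ k}"
  shows "pair_weight k (w / 2 ^ k) I J
    \<le> p k I * p k J * exp (pair_cost M (4 * M / (B - 1)) (card I) (card J))"
proof -
  define b where "b = 4 * M / (B - 1)"
  have M0: "0 \<le> M" using w by simp
  have b: "M \<le> b" unfolding b_def using B M0 mult_left_mono[of "B - 1" 4 M] by (simp add: le_divide_eq)
  have "pair_weight k (w / 2 ^ k) I J \<le> p k I * p k J * exp (pair_cost M b (card I) (card J))"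
    using k I J
  proof (induction k arbitrary: I J)
    case 0
    have "w \<le> pair_cost M b (card I) (card J)"
    proof -
      have "b \<le> b * real m" if "m > 0" for m
        using mult_left_mono[of 1 "real m" b] that b M0 by auto
      moreover have "b \<le> (b + M / 2) * real m" if "m > 0" for m
        using mult_mono[of b "b + M / 2" 1 "real m"] that b M0 by auto
      ultimately have "w \<le> b * real m" "w \<le> (b + M / 2) * real m" if "m > 0" for m
        using w b that by (meson order_trans)+
      then show ?thesis unfolding pair_cost_def using w by (auto simp del: of_nat_add)
    qed
    moreover have "prod (\<lambda>i. if i = 1 then 1 else 0) K = (1 :: real)" if "K \<subseteq> {1..2 ^ 0}" for K :: "nat set"
      using that by (intro prod.neutral) auto
    ultimately show ?case using "0.prems" by (simp add: pair_weight_def num_contacts_def)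
  next
    case (Suc k)
    let ?v = "w / 2 ^ Suc k"
    have v: "2 * ?v = w / 2 ^ k" by simp
    have fin: "finite I" "finite J" using Suc.prems finite_subset by blast+
    have quad: "quad_weight k ?v (left_half k I) (right_half k I) (left_half k J) (right_half k J)
      \<le> p k (left_half k I) * p k (right_half k I) * (p k (left_half k J) * p k (right_half k J))
        * exp ((pair_cost M b (card (left_half k I)) (card (left_half k J))
              + pair_cost M b (card (right_half k I)) (card (right_half k J))
              + pair_cost M b (card (left_half k I)) (card (right_half k J))
              + pair_cost M b (card (right_half k I)) (card (left_half k J))) / 2)"
      if "I \<subseteq> {1..2 ^ Suc k}" "J \<subseteq> {1..2 ^ Suc k}" for I J
      by (rule quad_weight_le; unfold v;
        intro Suc.IH[OF Suc_leD[OF Suc.prems(1)]] left_half_subset right_half_subset that)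
    have one: "pair_weight (Suc k) ?v I {} \<le> p (Suc k) I * exp (b * real (card I))"
      if I: "I \<subseteq> {1..2 ^ Suc k}" "I \<noteq> {}" for I
    proof -
      have fin: "finite I" using I finite_subset by blast
      let ?i = "card (left_half k I)" and ?i' = "card (right_half k I)"
      define c where "c = pair_cost M b ?i 0 + pair_cost M b ?i' 0"
      define P where "P = p k (left_half k I) * p k (right_half k I)"
      have P: "0 \<le> P" "p (Suc k) I = P / B" using I fin by (simp_all add: P_def E_prod_nonneg E_prod_Suc)
      have quadI: "quad_weight k ?v (left_half k I) (right_half k I) {} {} \<le> P * exp c"
        using quad[of I "{}"] I by (simp add: P_def c_def add_divide_distrib algebra_simps)
      have card: "card I = ?i + ?i'" "0 < card I" using card_halves[OF fin, of k] I fin card_gt_0_iff[of I] by auto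
      have exp_c: "1 - 1 / B + exp c / B \<le> exp (b * real (card I))"
      proof (cases "?i = 0 \<or> ?i' = 0")
        case True
        \<comment> \<open>As \<open>I\<close> is nonempty, only one of its halves is empty, so M
          enters just once.\<close>
        have "c = b * real (card I) + M" using True card by (auto simp: c_def pair_cost_def)
        moreover have "b \<le> b * real (card I)"
          using mult_left_mono[of 1 "real (card I)" b] card b M0 by auto
        ultimately show ?thesis
          using killing_absorbs_cost[of M "b * real (card I)"] M M0 by (simp add: b_def)
      next
        case False
        have c: "c = b * real (card I)" using False card by (auto simp: c_def pair_cost_def distrib_left)
        have "1 \<le> exp c" using b M0 by (simp add: c)
        then have "(1 - 1 / B) * 1 + exp c / B \<le> (1 - 1 / B) * exp c + exp c / B"
          using B by (intro add_mono mult_left_mono) auto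
        also have "\<dots> = exp c" by (simp add: algebra_simps)
        finally show ?thesis by (simp add: c)
      qed
      have "pair_weight (Suc k) ?v I {} = (1 - 1 / B) * (1 / B) * P
          + quad_weight k ?v (left_half k I) (right_half k I) {} {} / B\<^sup>2"
        using fin I by (simp add: pair_weight_Suc P_def)
      also have "\<dots> \<le> (1 - 1 / B) * (1 / B) * P + P * exp c / B\<^sup>2"
        using quadI by (intro add_mono divide_right_mono) auto
      also have "\<dots> = P / B * (1 - 1 / B + exp c / B)"
        using B by (simp add: power2_eq_square field_simps)
      also have "\<dots> \<le> P / B * exp (b * real (card I))"
        using exp_c P B by (intro mult_left_mono) auto
      finally show ?thesis using P by simp
    qed
    consider "I = {}" "J = {}" | "I \<noteq> {}" "J = {}" | "I = {}" "J \<noteq> {}" | "I \<noteq> {}" "J \<noteq> {}"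
      by blast
    then show ?case
    proof cases
      case 1
      then show ?thesis using empty[OF Suc.prems(1)] by (simp add: pair_cost_def)
    next
      case 2
      then show ?thesis using one[of I] Suc.prems fin by (simp add: pair_cost_def card_gt_0_iff)
    next
      case 3
      then show ?thesis using one[of J] Suc.prems fin
        by (simp add: pair_cost_def card_gt_0_iff pair_weight_commute[of _ _ "{}"])
    next
      case 4
      let ?P = "p k (left_half k I) * p k (right_half k I) * (p k (left_half k J) * p k (right_half k J))"
      have card: "card I = card (left_half k I) + card (right_half k I)" "0 < card I"
        "card J = card (left_half k J) + card (right_half k J)" "0 < card J"
        using 4 fin card_gt_0_iff[of I] card_gt_0_iff[of J] by (simp_all add: card_halves[symmetric])
      have P: "0 \<le> ?P" by (simp add: E_prod_nonneg)
      have "pair_weight (Suc k) ?v I J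
          = quad_weight k ?v (left_half k I) (right_half k I) (left_half k J) (right_half k J) / B\<^sup>2"
        using fin 4 by (simp add: pair_weight_Suc)
      also have "\<dots> \<le> ?P * exp (pair_cost M b (card I) (card J)) / B\<^sup>2"
        using pair_cost_split[OF M0, of "card (left_half k I)" "card (right_half k I)"
          "card (left_half k J)" "card (right_half k J)" b] card
        by (intro divide_right_mono order_trans[OF quad[OF Suc.prems(2,3)]] mult_left_mono P) auto
      also have "\<dots> = p (Suc k) I * p (Suc k) J * exp (pair_cost M b (card I) (card J))"
        using 4 fin by (simp add: E_prod_Suc power2_eq_square)
      finally show ?thesis .
    qed
  qed
  then show ?thesis by (simp add: b_def)
qed

section \<open>Decay rates and irrelevance of the interaction\<close>

definition q :: real where "q = 4 * \<kappa> / B\<^sup>2"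

definition r :: real where "r = max (2 * \<kappa>) q"

text \<open>For M = 4 V r^n this makes 4 M / (B - 1) + M / 2, the cost per site, equal to K V
  r^n.\<close>

definition K :: real where "K = 16 / (B - 1) + 2"

lemma q_bounds: "0 < q" "q < 1"
  using B \<kappa> by (auto simp: q_def)

lemma r_bounds: "0 < r" "r < 1"
  using q_bounds \<kappa> by (auto simp: r_def)

lemma K_pos: "0 < K"
  using B by (simp add: K_def add_pos_pos)

lemma geometric_sum_le:
  fixes s :: real
  assumes "0 \<le> s" "s < 1"
  shows "(\<Sum>j<n. s ^ j) \<le> 1 / (1 - s)"
  using sum_le_suminf[of "\<lambda>j. s ^ j" "{..<n}"] assms by (simp add: summable_geometric suminf_geometric)

text \<open>The interaction is irrelevant: at scale \<open>n\<close> its strength is \<open>\<kappa>\<^sup>n\<close>, whereas \<open>E n (S n)\<close> grows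
  like \<open>(2 / B)\<^sup>n\<close>, so its effect is \<open>(4 \<kappa> / B\<^sup>2)\<^sup>n\<close>; the rate \<open>2 \<kappa>\<close> covers dense sets \<open>I\<close> and \<open>J\<close>.\<close>

lemma pair_weight_irrelevant:
  assumes v: "0 \<le> v" "v \<le> V * \<kappa> ^ n" and V: "4 * V \<le> 1 - 2 * \<kappa>" "16 * V \<le> B - 1"
  shows "pair_weight n v {} {} - 1 \<le> 4 * V * q ^ n"
    and "\<lbrakk>I \<subseteq> {1..2 ^ n}; J \<subseteq> {1..2 ^ n}; I \<noteq> {} \<or> J \<noteq> {}\<rbrakk> \<Longrightarrow>
      pair_weight n v I J \<le> p n I * p n J * exp (K * V * r ^ n * real (card I + card J))"
proof -
  define \<rho> where "\<rho> = 2 / B\<^sup>2"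
  define w where "w = 2 ^ n * v"
  \<comment> \<open>M must dominate both w and the excess 4 w \<rho>^k at every scale k \<le> n.
    Since \<rho>^k turns k factors 2 \<kappa> into \<open>q\<close>, the larger rate
    \<open>r\<close> covers all of them.\<close>
  define M where "M = 4 * V * r ^ n"
  have \<rho>: "0 < \<rho>" "2 * \<kappa> * \<rho> = q" using B by (simp_all add: \<rho>_def q_def)
  have wn: "w / 2 ^ n = v" by (simp add: w_def)
  have V0: "0 \<le> V" using order_trans[OF v] zero_less_power[OF \<kappa>(1), of n] by (simp add: zero_le_mult_iff)
  have w: "0 \<le> w" "w \<le> V * (2 * \<kappa>) ^ n"
    using v mult_left_mono[OF v(2), of "2 ^ n"] by (simp_all add: w_def power_mult_distrib mult_ac)
  have w\<rho>: "w * \<rho> ^ k \<le> V * ((2 * \<kappa>) ^ (n - k) * q ^ k)" if "k \<le> n" for k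
  proof -
    have "w * \<rho> ^ k \<le> V * (2 * \<kappa>) ^ n * \<rho> ^ k" using w \<rho> by (intro mult_right_mono) auto
    also have "(2 * \<kappa>) ^ n = (2 * \<kappa>) ^ (n - k) * (2 * \<kappa>) ^ k"
      unfolding power_add[symmetric] using that by simp
    also have "V * ((2 * \<kappa>) ^ (n - k) * (2 * \<kappa>) ^ k) * \<rho> ^ k = V * ((2 * \<kappa>) ^ (n - k) * q ^ k)"
      by (simp add: power_mult_distrib flip: \<rho>(2))
    finally show ?thesis .
  qed
  have w1: "w \<le> 1"
  proof -
    have "V * (2 * \<kappa>) ^ n \<le> V" using V0 \<kappa> by (intro mult_left_le power_le_one) auto
    then show ?thesis using w V \<kappa> by linarith
  qed
  have sum: "2 * w * (\<Sum>j<n. \<rho> ^ j) \<le> 1 / 2"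
  proof -
    have "w * (\<Sum>j<n. \<rho> ^ j) = (\<Sum>j<n. w * \<rho> ^ j)" by (simp add: sum_distrib_left)
    \<comment> \<open>The powers of \<open>q\<close> are dropped, and one power of 2 \<kappa> is
      given away so that the reversed sum is a plain geometric one.\<close>
    also have "\<dots> \<le> (\<Sum>j<n. V * (2 * \<kappa>) ^ (n - Suc j))"
    proof (rule sum_mono)
      fix j assume j: "j \<in> {..<n}"
      have "(2 * \<kappa>) ^ (n - j) * q ^ j \<le> (2 * \<kappa>) ^ (n - Suc j) * 1"
        using q_bounds \<kappa> j by (intro mult_mono power_decreasing power_le_one) auto
      then have "V * ((2 * \<kappa>) ^ (n - j) * q ^ j) \<le> V * (2 * \<kappa>) ^ (n - Suc j)"
        using V0 by (intro mult_left_mono) auto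
      then show "w * \<rho> ^ j \<le> V * (2 * \<kappa>) ^ (n - Suc j)" using w\<rho>[of j] j by auto
    qed
    also have "\<dots> = V * (\<Sum>j<n. (2 * \<kappa>) ^ j)"
      unfolding sum_distrib_left by (rule sum.nat_diff_reindex)
    also have "\<dots> \<le> V * (1 / (1 - 2 * \<kappa>))"
      using V0 \<kappa> by (intro mult_left_mono geometric_sum_le) auto
    also have "\<dots> \<le> 1 / 4" using V(1) \<kappa> by (simp add: field_simps)
    finally show ?thesis by linarith
  qed
  note empty = pair_weight_empty_le[of w n, folded \<rho>_def, OF w(1) w1 sum]
  show "pair_weight n v {} {} - 1 \<le> 4 * V * q ^ n"
    using empty[of n] w\<rho>[of n] by (simp add: wn)
  have wM: "w \<le> M"
  proof -
    have "V * (2 * \<kappa>) ^ n \<le> V * r ^ n"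
      using V0 \<kappa> by (intro mult_left_mono power_mono) (auto simp: r_def)
    moreover have "0 \<le> V * r ^ n" using V0 r_bounds by simp
    ultimately show ?thesis using w by (simp add: M_def)
  qed
  have MV: "M \<le> 4 * V" using V0 r_bounds by (simp add: M_def mult_left_le power_le_one)
  have emptyM: "pair_weight k (w / 2 ^ k) {} {} \<le> exp M" if "k \<le> n" for k
  proof -
    have "(2 * \<kappa>) ^ (n - k) * q ^ k \<le> r ^ (n - k) * r ^ k"
      using \<kappa> q_bounds r_bounds by (intro mult_mono power_mono) (auto simp: r_def)
    also have "\<dots> = r ^ n" unfolding power_add[symmetric] using that by simp
    finally have "V * ((2 * \<kappa>) ^ (n - k) * q ^ k) \<le> V * r ^ n" using V0 by (intro mult_left_mono)
    then have "pair_weight k (w / 2 ^ k) {} {} \<le> 1 + M"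
      using empty[OF that] w\<rho>[OF that] by (simp add: M_def)
    also have "\<dots> \<le> exp M" by simp
    finally show ?thesis .
  qed
  show "pair_weight n v I J \<le> p n I * p n J * exp (K * V * r ^ n * real (card I + card J))"
    if IJ: "I \<subseteq> {1..2 ^ n}" "J \<subseteq> {1..2 ^ n}" "I \<noteq> {} \<or> J \<noteq> {}"
  proof -
    have "finite I" "finite J" using IJ finite_subset by blast+
    then have "card I \<noteq> 0 \<or> card J \<noteq> 0" using IJ by auto
    then have "pair_cost M (4 * M / (B - 1)) (card I) (card J)
        \<le> (4 * M / (B - 1) + M / 2) * real (card I + card J)"
      using w wM by (intro pair_cost_le) auto
    also have "4 * M / (B - 1) + M / 2 = K * V * r ^ n"
      by (simp add: M_def K_def field_simps add_divide_distrib)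
    finally have cost: "pair_cost M (4 * M / (B - 1)) (card I) (card J)
        \<le> K * V * r ^ n * real (card I + card J)" .
    have "pair_weight n (w / 2 ^ n) I J
        \<le> p n I * p n J * exp (pair_cost M (4 * M / (B - 1)) (card I) (card J))"
      using MV V \<kappa> by (intro pair_weight_le[where n = n] w wM emptyM IJ) auto
    also have "\<dots> \<le> p n I * p n J * exp (K * V * r ^ n * real (card I + card J))"
      using cost by (intro mult_left_mono mult_nonneg_nonneg E_prod_nonneg) auto
    finally show ?thesis by (simp add: wn)
  qed
qed

section \<open>The tilted measure\<close>

abbreviation H :: "real \<Rightarrow> real \<Rightarrow> nat \<Rightarrow> (nat \<Rightarrow> real) \<Rightarrow> real" where
  "H \<equiv> annealed_hamiltonian \<kappa>"

abbreviation Z :: "real \<Rightarrow> real \<Rightarrow> nat \<Rightarrow> real" where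
  "Z \<equiv> annealed_partition B \<kappa>"

abbreviation T :: "real \<Rightarrow> real \<Rightarrow> nat \<Rightarrow> nat set \<Rightarrow> real" where
  "T \<beta> h n I \<equiv> E n (\<lambda>x. prod x I * exp (H \<beta> h n x))"

definition tilted_pair :: "real \<Rightarrow> real \<Rightarrow> nat \<Rightarrow> nat set \<Rightarrow> nat set \<Rightarrow> real" where
  "tilted_pair \<beta> h n I J = E n (\<lambda>x. E n (\<lambda>y. (prod x I * exp (H \<beta> h n x)) * (prod y J * exp (H \<beta> h n y))
     * exp (\<beta>\<^sup>2 * \<kappa> ^ Suc n * (S n x * S n y))))"

lemma Z_eq_T: "Z \<beta> h n = T \<beta> h n {}"
  by (simp add: annealed_partition_def)

lemma T_Suc:
  assumes "finite I"
  shows "T \<beta> h (Suc n) I = (if I = {} then 1 - 1 / B else 0)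
    + tilted_pair \<beta> h n (left_half n I) (right_half n I) / B"
proof -
  have H0: "H \<beta> h m (\<lambda>_. 0) = 0" for m by (simp add: annealed_hamiltonian_def num_contacts_def)
  show ?thesis
    unfolding tilted_pair_def E_Suc using assms
    by (simp add: power_0_left card_eq_0_iff H0 prod_join_config annealed_hamiltonian_join_config
        exp_add mult_ac)
qed

text \<open>Expanding the exponential decouples the copies: each power of S S' is a product of one
  moment per copy. The finite supports allow expectation term by term.\<close>

lemma pair_exp_sums:
  "(\<lambda>k. u ^ k / fact k * (E n (\<lambda>x. a x * S n x ^ k) * E n (\<lambda>y. b y * S n y ^ k)))
    sums E n (\<lambda>x. E n (\<lambda>y. a x * b y * exp (u * (S n x * S n y))))"
proof -
  have "(\<lambda>k. E n (\<lambda>x. E n (\<lambda>y. a x * b y * ((u * (S n x * S n y)) ^ k /\<^sub>R fact k))))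
      sums E n (\<lambda>x. E n (\<lambda>y. a x * b y * exp (u * (S n x * S n y))))"
    by (intro E_sums sums_mult exp_converges)
  also have "(\<lambda>k. E n (\<lambda>x. E n (\<lambda>y. a x * b y * ((u * (S n x * S n y)) ^ k /\<^sub>R fact k)))) =
    (\<lambda>k. u ^ k / fact k * (E n (\<lambda>x. a x * S n x ^ k) * E n (\<lambda>y. b y * S n y ^ k)))"
  proof
    fix k
    have "E n (\<lambda>x. E n (\<lambda>y. a x * b y * ((u * (S n x * S n y)) ^ k /\<^sub>R fact k)))
        = E n (\<lambda>x. E n (\<lambda>y. u ^ k / fact k * ((a x * S n x ^ k) * (b y * S n y ^ k))))"
      by (intro E_cong) (simp add: power_mult_distrib field_simps)
    then show "E n (\<lambda>x. E n (\<lambda>y. a x * b y * ((u * (S n x * S n y)) ^ k /\<^sub>R fact k))) =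
      u ^ k / fact k * (E n (\<lambda>x. a x * S n x ^ k) * E n (\<lambda>y. b y * S n y ^ k))"
      by simp
  qed
  finally show ?thesis .
qed

text \<open>Subtracting the terms without interaction matters for \<open>I = J = {}\<close>, where the bound must be
  \<open>Z\<^sup>2\<close> plus a small error.\<close>

lemma tilted_pair_le:
  assumes bound: "\<And>I. I \<subseteq> {1..2 ^ n} \<Longrightarrow> T \<beta> h n I \<le> exp (c * real (card I)) * p n I"
    and c: "0 \<le> c" and I: "I \<subseteq> {1..2 ^ n}" and J: "J \<subseteq> {1..2 ^ n}"
  shows "tilted_pair \<beta> h n I J - T \<beta> h n I * T \<beta> h n J
    \<le> exp (c * real (card I + card J))
      * (pair_weight n (\<beta>\<^sup>2 * \<kappa> ^ Suc n * exp (2 * c)) I J - p n I * p n J)"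
proof -
  define u where "u = \<beta>\<^sup>2 * \<kappa> ^ Suc n"
  have u: "0 \<le> u" using \<kappa> by (simp add: u_def)
  let ?f = "\<lambda>k. u ^ k / fact k * (E n (\<lambda>x. prod x I * exp (H \<beta> h n x) * S n x ^ k)
      * E n (\<lambda>y. prod y J * exp (H \<beta> h n y) * S n y ^ k))"
  let ?g = "\<lambda>k. (u * exp (2 * c)) ^ k / fact k * (E n (\<lambda>x. prod x I * S n x ^ k) * E n (\<lambda>y. prod y J * S n y ^ k))"
  have nonneg: "0 \<le> E n (\<lambda>x. prod x I * S n x ^ k)" for I k
    by (intro E_nonneg mult_nonneg_nonneg prod_config_nonneg zero_le_power num_contacts_nonneg)
  have nonneg': "0 \<le> E n (\<lambda>x. prod x I * exp (H \<beta> h n x) * S n x ^ k)" for I k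
    by (intro E_nonneg mult_nonneg_nonneg prod_config_nonneg zero_le_power num_contacts_nonneg) auto
  have "?f sums (tilted_pair \<beta> h n I J - T \<beta> h n I * T \<beta> h n J + ?f 0)"
    using pair_exp_sums[of u n "\<lambda>x. prod x I * exp (H \<beta> h n x)" "\<lambda>y. prod y J * exp (H \<beta> h n y)"]
    by (simp add: tilted_pair_def u_def)
  then have f: "(\<lambda>k. ?f (Suc k)) sums (tilted_pair \<beta> h n I J - T \<beta> h n I * T \<beta> h n J)"
    by (rule iffD2[OF sums_Suc_iff[of ?f]])
  have "?g sums (pair_weight n (u * exp (2 * c)) I J - p n I * p n J + ?g 0)"
    using pair_exp_sums[of "u * exp (2 * c)" n "\<lambda>x. prod x I" "\<lambda>y. prod y J"]
    by (simp add: pair_weight_def)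
  then have "(\<lambda>k. ?g (Suc k)) sums (pair_weight n (u * exp (2 * c)) I J - p n I * p n J)"
    by (rule iffD2[OF sums_Suc_iff[of ?g]])
  then have g: "(\<lambda>k. exp (c * real (card I + card J)) * ?g (Suc k))
      sums (exp (c * real (card I + card J)) * (pair_weight n (u * exp (2 * c)) I J - p n I * p n J))"
    by (rule sums_mult)
  have "?f k \<le> exp (c * real (card I + card J)) * ?g k" for k
  proof -
    have moment: "E n (\<lambda>x. prod x I * exp (H \<beta> h n x) * S n x ^ k)
        \<le> exp (c * real (card I + k)) * E n (\<lambda>x. prod x I * S n x ^ k)" if "I \<subseteq> {1..2 ^ n}" for I
      using E_prod_power_le[OF bound c that] by (simp add: mult_ac)
    have "?f k \<le> u ^ k / fact k * ((exp (c * real (card I + k)) * E n (\<lambda>x. prod x I * S n x ^ k))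
        * (exp (c * real (card J + k)) * E n (\<lambda>x. prod x J * S n x ^ k)))"
      using u by (intro mult_left_mono mult_mono moment I J nonneg' mult_nonneg_nonneg nonneg) auto
    \<comment> \<open>Each power of S S' adds one site to either copy and thus costs exp (2 c),
      which is absorbed into the coupling.\<close>
    also have "\<dots> = exp (c * real (card I + card J)) * ?g k"
    proof -
      have "exp (c * real (card I + k)) * exp (c * real (card J + k))
          = exp (c * real (card I + card J)) * exp (2 * c) ^ k"
        by (simp add: algebra_simps flip: exp_add exp_of_nat_mult)
      then show ?thesis by (simp add: power_mult_distrib mult_ac)
    qed
    finally show ?thesis .
  qed
  then show ?thesis unfolding u_def[symmetric] by (intro sums_le[OF _ f g])
qed

text \<open>The first two conditions admit \<open>pair_weight_irrelevant\<close> with V = 2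
  \<beta>^2, the third bounds \<open>cost\<close> by 1/4, and the last two serve
  \<open>gap_bounds\<close>.\<close>

definition small :: "real \<Rightarrow> bool" where
  "small \<beta> \<longleftrightarrow> 8 * \<beta>\<^sup>2 \<le> 1 - 2 * \<kappa> \<and> 32 * \<beta>\<^sup>2 \<le> B - 1 \<and> 8 * K * \<beta>\<^sup>2 \<le> 1 - r
    \<and> 16 * \<beta>\<^sup>2 \<le> 1 - q \<and> 8 * \<beta>\<^sup>2 \<le> (2 - B) * (1 - q)"

text \<open>The exponent per site accumulated below scale n, where scale j contributes K V r^j with
  V = 2 \<beta>^2.\<close>

definition cost :: "real \<Rightarrow> nat \<Rightarrow> real" where
  "cost \<beta> n = 2 * K * \<beta>\<^sup>2 * (\<Sum>j<n. r ^ j)"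

lemma cost_nonneg: "0 \<le> cost \<beta> n"
  using K_pos r_bounds by (simp add: cost_def sum_nonneg)

lemma cost_le: "cost \<beta> n \<le> 2 * K * \<beta>\<^sup>2 / (1 - r)"
  using mult_left_mono[OF geometric_sum_le[of r n], of "2 * K * \<beta>\<^sup>2"] K_pos r_bounds
  by (simp add: cost_def)

lemma cost_le_quarter:
  assumes "small \<beta>"
  shows "cost \<beta> n \<le> 1 / 4"
proof -
  have "2 * K * \<beta>\<^sup>2 / (1 - r) \<le> 1 / 4"
    using assms r_bounds by (simp add: small_def field_simps)
  then show ?thesis using cost_le[of \<beta> n] by simp
qed

lemma T_nonneg: "0 \<le> T \<beta> h n I"
  by (intro E_nonneg mult_nonneg_nonneg prod_config_nonneg) auto

lemma tilted_pair_small_le: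
  assumes small: "small \<beta>"
    and bound: "\<And>I. I \<subseteq> {1..2 ^ n} \<Longrightarrow> T \<beta> h n I \<le> exp (cost \<beta> n * real (card I)) * p n I"
  shows "tilted_pair \<beta> h n {} {} \<le> (Z \<beta> h n)\<^sup>2 + 8 * \<beta>\<^sup>2 * q ^ n"
    and "\<lbrakk>I \<subseteq> {1..2 ^ n}; J \<subseteq> {1..2 ^ n}; I \<noteq> {} \<or> J \<noteq> {}\<rbrakk> \<Longrightarrow>
      tilted_pair \<beta> h n I J \<le> exp (cost \<beta> (Suc n) * real (card I + card J)) * (p n I * p n J)"
proof -
  let ?c = "cost \<beta> n"
  let ?v = "\<beta>\<^sup>2 * \<kappa> ^ Suc n * exp (2 * ?c)"
  \<comment> \<open>The tilt inflates the coupling by at most 2 because the total cost is at most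
    1/4; hence V = 2 \<beta>^2.\<close>
  have "exp (2 * ?c) \<le> exp (1 / 2)" using cost_le_quarter[OF small, of n] by simp
  also have "\<dots> \<le> (2 :: real)" using exp_bound[of "1 / 2 :: real"] by (simp add: power2_eq_square)
  finally have "?v \<le> \<beta>\<^sup>2 * \<kappa> ^ n * 2"
    using \<kappa> by (intro mult_mono mult_left_mono power_decreasing) auto
  then have v: "0 \<le> ?v" "?v \<le> 2 * \<beta>\<^sup>2 * \<kappa> ^ n" using \<kappa> by (simp_all add: mult_ac)
  have V: "4 * (2 * \<beta>\<^sup>2) \<le> 1 - 2 * \<kappa>" "16 * (2 * \<beta>\<^sup>2) \<le> B - 1" using small by (auto simp: small_def)
  note pw = pair_weight_irrelevant[OF v V]
  have tp: "tilted_pair \<beta> h n I J - T \<beta> h n I * T \<beta> h n J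
      \<le> exp (?c * real (card I + card J)) * (pair_weight n ?v I J - p n I * p n J)"
    if "I \<subseteq> {1..2 ^ n}" "J \<subseteq> {1..2 ^ n}" for I J
    by (rule tilted_pair_le) (use bound cost_nonneg that in auto)
  show "tilted_pair \<beta> h n {} {} \<le> (Z \<beta> h n)\<^sup>2 + 8 * \<beta>\<^sup>2 * q ^ n"
    using tp[of "{}" "{}"] pw(1) by (simp add: Z_eq_T power2_eq_square)
  show "tilted_pair \<beta> h n I J \<le> exp (cost \<beta> (Suc n) * real (card I + card J)) * (p n I * p n J)"
    if IJ: "I \<subseteq> {1..2 ^ n}" "J \<subseteq> {1..2 ^ n}" "I \<noteq> {} \<or> J \<noteq> {}"
  proof -
    have "T \<beta> h n I * T \<beta> h n J \<le> (exp (?c * real (card I)) * p n I) * (exp (?c * real (card J)) * p n J)"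
      using IJ by (intro mult_mono bound T_nonneg mult_nonneg_nonneg E_prod_nonneg) auto
    also have "\<dots> = exp (?c * real (card I + card J)) * (p n I * p n J)"
      by (simp add: distrib_left exp_add)
    finally have "tilted_pair \<beta> h n I J \<le> exp (?c * real (card I + card J)) * pair_weight n ?v I J"
      using tp[OF IJ(1,2)] by (simp add: right_diff_distrib)
    also have "\<dots> \<le> exp (?c * real (card I + card J))
        * (p n I * p n J * exp (K * (2 * \<beta>\<^sup>2) * r ^ n * real (card I + card J)))"
      using IJ by (intro mult_left_mono pw) auto
    also have "\<dots> = exp (cost \<beta> (Suc n) * real (card I + card J)) * (p n I * p n J)"
      by (simp add: cost_def distrib_left distrib_right exp_add mult_ac)
    finally show ?thesis .
  qed
qed

lemma T_0: "I \<subseteq> {1..2 ^ 0} \<Longrightarrow> T \<beta> h 0 I = exp (h + \<beta>\<^sup>2 / 2)"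
proof -
  assume I: "I \<subseteq> {1..2 ^ 0}"
  have "hier_dist (Suc 0) (Suc 0) = 0" by (subst hier_dist_eq) (auto intro: Least_equality)
  moreover have "(\<Prod>i\<in>I. if i = Suc 0 then 1 else 0 :: real) = 1"
    using I by (intro prod.neutral) auto
  ultimately show ?thesis by (simp add: annealed_hamiltonian_def num_contacts_def)
qed

lemma p_0: "I \<subseteq> {1..2 ^ 0} \<Longrightarrow> p 0 I = 1"
proof -
  assume "I \<subseteq> {1..2 ^ 0}"
  then have "(\<Prod>i\<in>I. if i = Suc 0 then 1 else 0 :: real) = 1" by (intro prod.neutral) auto
  then show ?thesis by simp
qed

lemma Z_0: "Z \<beta> h 0 = exp (h + \<beta>\<^sup>2 / 2)"
  unfolding Z_eq_T by (rule T_0) simp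

text \<open>For the empty set the bound is the hypothesis Z \<le> 1, which also covers empty halves
  in the induction. A nonempty set forces survival, so the factor 1 / B appears on both
  sides.\<close>

lemma T_le:
  assumes small: "small \<beta>" and Z: "\<And>k. k \<le> n \<Longrightarrow> Z \<beta> h k \<le> 1" and I: "I \<subseteq> {1..2 ^ n}"
  shows "T \<beta> h n I \<le> exp (cost \<beta> n * real (card I)) * p n I"
  using Z I
proof (induction n arbitrary: I)
  case 0
  then show ?case using T_0[of I] p_0[of I] Z_0 by (simp add: cost_def)
next
  case (Suc n)
  show ?case
  proof (cases "I = {}")
    case True
    then show ?thesis using Suc.prems(1)[of "Suc n"] by (simp add: Z_eq_T)
  next
    case False
    have fin: "finite I" using Suc.prems(2) finite_subset by blast
    have "0 < card I" using False fin by (simp add: card_gt_0_iff)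
    then have ne: "left_half n I \<noteq> {} \<or> right_half n I \<noteq> {}" using card_halves[OF fin, of n] by auto
    have "T \<beta> h (Suc n) I = tilted_pair \<beta> h n (left_half n I) (right_half n I) / B"
      using T_Suc[OF fin] False by simp
    also have "\<dots> \<le> exp (cost \<beta> (Suc n) * real (card (left_half n I) + card (right_half n I)))
        * (p n (left_half n I) * p n (right_half n I)) / B"
      using Suc B ne
      by (intro divide_right_mono tilted_pair_small_le[OF small] left_half_subset right_half_subset) auto
    also have "\<dots> = exp (cost \<beta> (Suc n) * real (card I)) * p (Suc n) I"
      using False fin by (simp add: E_prod_Suc card_halves[OF fin, of n])
    finally show ?thesis .
  qed
qed

section \<open>Recursion and growth of the partition function\<close>

lemma Z_Suc: "Z \<beta> h (Suc n) = 1 - 1 / B + tilted_pair \<beta> h n {} {} / B"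
  unfolding Z_eq_T by (subst T_Suc) simp_all

lemma Z_Suc_le:
  assumes "small \<beta>" "\<And>k. k \<le> n \<Longrightarrow> Z \<beta> h k \<le> 1"
  shows "Z \<beta> h (Suc n) \<le> 1 - 1 / B + ((Z \<beta> h n)\<^sup>2 + 8 * \<beta>\<^sup>2 * q ^ n) / B"
  unfolding Z_Suc using B T_le[OF assms]
  by (intro add_left_mono divide_right_mono tilted_pair_small_le(1)[OF assms(1)]) auto

text \<open>The two halves attract each other: the discarded interaction factor is at least
  1.\<close>

lemma tilted_pair_ge: "T \<beta> h n I * T \<beta> h n J \<le> tilted_pair \<beta> h n I J"
proof -
  have "T \<beta> h n I * T \<beta> h n J
      = E n (\<lambda>x. E n (\<lambda>y. (prod x I * exp (H \<beta> h n x)) * (prod y J * exp (H \<beta> h n y)) * 1))"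
    by simp
  also have "\<dots> \<le> tilted_pair \<beta> h n I J"
    unfolding tilted_pair_def using \<kappa>
    by (intro E_mono mult_left_mono mult_nonneg_nonneg prod_config_nonneg)
       (auto simp: num_contacts_nonneg)
  finally show ?thesis .
qed

lemma Z_Suc_ge: "1 - 1 / B + (Z \<beta> h n)\<^sup>2 / B \<le> Z \<beta> h (Suc n)"
  unfolding Z_Suc using B tilted_pair_ge[where I = "{}" and J = "{}"]
  by (simp add: Z_eq_T power2_eq_square divide_right_mono)

lemma Z_pos: "0 < Z \<beta> h n"
proof (cases n)
  case (Suc k)
  have "0 < 1 - 1 / B + (Z \<beta> h k)\<^sup>2 / B" using B by (intro add_pos_nonneg) auto
  also have "\<dots> \<le> Z \<beta> h n" unfolding Suc by (rule Z_Suc_ge)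
  finally show ?thesis .
qed (simp add: Z_0)

lemma Z_ge: "1 \<le> n \<Longrightarrow> 1 - 1 / B \<le> Z \<beta> h n"
proof -
  assume "1 \<le> n"
  then obtain k where n: "n = Suc k" by (cases n) auto
  have "0 \<le> (Z \<beta> h k)\<^sup>2 / B" using B by simp
  then show ?thesis unfolding n using Z_Suc_ge[of \<beta> h k] by linarith
qed

text \<open>The map z \<mapsto> 1 - 1 / B + z^2 / B fixes 1 with slope 2 / B there, and by convexity
  it lies above its tangent.\<close>

lemma Z_Suc_growth:
  assumes "1 \<le> Z \<beta> h n"
  shows "2 / B * (Z \<beta> h n - 1) \<le> Z \<beta> h (Suc n) - 1"
proof -
  have "0 \<le> (Z \<beta> h n - 1)\<^sup>2" by simp
  then have "2 * (Z \<beta> h n - 1) \<le> (Z \<beta> h n)\<^sup>2 - 1" by (simp add: power2_eq_square algebra_simps)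
  then have "2 * (Z \<beta> h n - 1) / B \<le> ((Z \<beta> h n)\<^sup>2 - 1) / B" using B by (intro divide_right_mono) auto
  then show ?thesis using Z_Suc_ge[of \<beta> h n] by (simp add: diff_divide_distrib)
qed

lemma Z_growth:
  assumes "1 \<le> Z \<beta> h n"
  shows "(2 / B) ^ k * (Z \<beta> h n - 1) \<le> Z \<beta> h (n + k) - 1"
proof (induction k)
  case (Suc k)
  have ge: "1 \<le> Z \<beta> h (n + k)"
  proof -
    have "0 \<le> (2 / B) ^ k * (Z \<beta> h n - 1)" using assms B by simp
    then show ?thesis using Suc by linarith
  qed
  have "(2 / B) ^ Suc k * (Z \<beta> h n - 1) = 2 / B * ((2 / B) ^ k * (Z \<beta> h n - 1))" by simp
  also have "\<dots> \<le> 2 / B * (Z \<beta> h (n + k) - 1)" using Suc B by (intro mult_left_mono) auto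
  also have "\<dots> \<le> Z \<beta> h (n + Suc k) - 1" using Z_Suc_growth[OF ge] by simp
  finally show ?case .
qed simp

text \<open>Any excess over 1 grows at least by the factor 2 / B > 1 per scale and is therefore
  unbounded.\<close>

lemma Z_bounded_imp_le_1:
  assumes "\<And>k. Z \<beta> h k \<le> C"
  shows "Z \<beta> h n \<le> 1"
proof (rule ccontr)
  assume "\<not> Z \<beta> h n \<le> 1"
  then have gt: "0 < Z \<beta> h n - 1" by simp
  have "1 < 2 / B" using B by simp
  then obtain k where "(C - 1) / (Z \<beta> h n - 1) < (2 / B) ^ k" using real_arch_pow by blast
  then have "C - 1 < (2 / B) ^ k * (Z \<beta> h n - 1)" using gt by (simp add: divide_less_eq)
  then show False using Z_growth[of \<beta> h n k] gt assms[of "n + k"] by simp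
qed

text \<open>By the arithmetic-geometric mean inequality and \<open>S \<le> 2\<^sup>n\<close>, the pair interaction is dominated by
  a shift of the field \<open>h\<close>, since \<open>2 \<kappa> < 1\<close>.\<close>

lemma H_le:
  "x \<in> configs n \<Longrightarrow> H \<beta> h n x \<le> (h + \<beta>\<^sup>2 / 2 * (1 + (\<Sum>j<n. (2 * \<kappa>) ^ j))) * S n x"
proof (induction n arbitrary: x)
  case 0
  have "hier_dist (Suc 0) (Suc 0) = 0" by (subst hier_dist_eq) (auto intro: Least_equality)
  then show ?case using 0 by (simp add: annealed_hamiltonian_def num_contacts_def)
next
  case (Suc n)
  let ?a = "\<lambda>n. h + \<beta>\<^sup>2 / 2 * (1 + (\<Sum>j<n. (2 * \<kappa>) ^ j))"
  from Suc.prems show ?case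
  proof (cases rule: set_hier_pmf_Suc)
    case 1
    then show ?thesis by (simp add: annealed_hamiltonian_def num_contacts_def)
  next
    case (2 y z)
    have s: "0 \<le> S n y" "S n y \<le> 2 ^ n" "0 \<le> S n z" "S n z \<le> 2 ^ n"
      using 2 num_contacts_nonneg num_contacts_le by auto
    have "S n y * S n z \<le> 2 ^ n * S n z" "S n y * S n z \<le> S n y * 2 ^ n"
      using s by (simp_all add: mult_right_mono mult_left_mono)
    then have "S n y * S n z \<le> 2 ^ n * (S n y + S n z) / 2" by (simp add: algebra_simps)
    then have "\<beta>\<^sup>2 * \<kappa> ^ Suc n * (S n y * S n z) \<le> \<beta>\<^sup>2 * \<kappa> ^ Suc n * (2 ^ n * (S n y + S n z) / 2)"
      using \<kappa> by (intro mult_left_mono) auto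
    also have "\<dots> = \<kappa> * (\<beta>\<^sup>2 / 2 * (2 * \<kappa>) ^ n * (S n y + S n z))" by (simp add: power_mult_distrib)
    also have "\<dots> \<le> \<beta>\<^sup>2 / 2 * (2 * \<kappa>) ^ n * (S n y + S n z)"
      using \<kappa> s by (intro mult_left_le_one_le) auto
    finally have "H \<beta> h (Suc n) x \<le> ?a n * S n y + ?a n * S n z + \<beta>\<^sup>2 / 2 * (2 * \<kappa>) ^ n * (S n y + S n z)"
      unfolding 2 annealed_hamiltonian_join_config using Suc.IH[of y] Suc.IH[of z] 2 by linarith
    also have "\<dots> = ?a (Suc n) * S (Suc n) x"
      unfolding 2 num_contacts_join_config by (simp add: algebra_simps add_divide_distrib)
    finally show ?thesis .
  qed
qed

section \<open>The critical point\<close>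

text \<open>The field shift of \<open>H_le\<close> with the partial geometric sum replaced by its
  limit, hence uniform in the scale.\<close>

definition shift :: "real \<Rightarrow> real" where
  "shift \<beta> = \<beta>\<^sup>2 / 2 * (1 + 1 / (1 - 2 * \<kappa>))"

lemma H_le_shift:
  assumes "x \<in> configs n"
  shows "H \<beta> h n x \<le> (h + shift \<beta>) * S n x"
proof -
  have "h + \<beta>\<^sup>2 / 2 * (1 + (\<Sum>j<n. (2 * \<kappa>) ^ j)) \<le> h + shift \<beta>"
    unfolding shift_def using \<kappa> by (intro add_left_mono mult_left_mono geometric_sum_le) auto
  then have "(h + \<beta>\<^sup>2 / 2 * (1 + (\<Sum>j<n. (2 * \<kappa>) ^ j))) * S n x \<le> (h + shift \<beta>) * S n x"
    using assms by (intro mult_right_mono num_contacts_nonneg)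
  then show ?thesis using H_le[OF assms, of \<beta> h] by linarith
qed

lemma Z_le_exp: "Z \<beta> h n \<le> exp (\<bar>h + shift \<beta>\<bar> * 2 ^ n)"
proof -
  have "Z \<beta> h n \<le> E n (\<lambda>x. exp (\<bar>h + shift \<beta>\<bar> * 2 ^ n))"
    unfolding annealed_partition_def
  proof (intro E_mono)
    fix x assume x: "x \<in> configs n"
    have "H \<beta> h n x \<le> (h + shift \<beta>) * S n x" using x by (rule H_le_shift)
    also have "\<dots> \<le> \<bar>h + shift \<beta>\<bar> * 2 ^ n"
      using x by (intro mult_mono num_contacts_le num_contacts_nonneg) auto
    finally show "exp (H \<beta> h n x) \<le> exp (\<bar>h + shift \<beta>\<bar> * 2 ^ n)" by simp
  qed
  then show ?thesis by simp
qed

lemma Z_le_1_of_small_h: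
  assumes "h \<le> - shift \<beta>"
  shows "Z \<beta> h n \<le> 1"
proof -
  have "Z \<beta> h n \<le> E n (\<lambda>x. 1)"
    unfolding annealed_partition_def
  proof (intro E_mono)
    fix x assume x: "x \<in> configs n"
    have "H \<beta> h n x \<le> (h + shift \<beta>) * S n x" using x by (rule H_le_shift)
    also have "\<dots> \<le> 0" using x assms by (intro mult_nonpos_nonneg num_contacts_nonneg) auto
    finally show "exp (H \<beta> h n x) \<le> 1" by simp
  qed
  then show ?thesis by simp
qed

text \<open>The corrected sequence \<open>2\<^bsup>-n\<^esup> (ln Z - ln B)\<close> is increasing because \<open>Z\<^bsub>n+1\<^esub> \<ge> Z\<^sub>n\<^sup>2 / B\<close>.\<close>

lemma annealed_free_energy_eq_0_iff:
  "annealed_free_energy B \<kappa> \<beta> h = 0 \<longleftrightarrow> (\<forall>n. Z \<beta> h n \<le> 1)"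
proof
  let ?f = "\<lambda>n. ln (Z \<beta> h n) / 2 ^ n"
  let ?g = "\<lambda>n. ?f n - ln B / 2 ^ n"
  have B0: "(\<lambda>n. C / 2 ^ n) \<longlonglongrightarrow> 0" for C :: real
    using tendsto_mult_right_zero[OF LIMSEQ_power_zero[of "1 / 2 :: real"], of C]
    by (simp add: power_divide)
  {
    assume F: "annealed_free_energy B \<kappa> \<beta> h = 0"
    have inc: "incseq ?g"
    proof (rule incseq_SucI)
      fix n
      have "(Z \<beta> h n)\<^sup>2 / B \<le> Z \<beta> h (Suc n)"
        using Z_Suc_ge[of \<beta> h n] B by (simp add: order_trans[rotated])
      then have "ln ((Z \<beta> h n)\<^sup>2 / B) \<le> ln (Z \<beta> h (Suc n))"
        using Z_pos[of \<beta> h n] B by (intro ln_mono) auto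
      also have "ln ((Z \<beta> h n)\<^sup>2 / B) = 2 * ln (Z \<beta> h n) - ln B"
        using Z_pos[of \<beta> h n] B by (simp add: ln_div ln_realpow)
      finally have "(ln (Z \<beta> h n) - ln B) / 2 ^ n \<le> (ln (Z \<beta> h (Suc n)) - ln B) / 2 / 2 ^ n"
        by (intro divide_right_mono) auto
      then show "?g n \<le> ?g (Suc n)" by (simp add: diff_divide_distrib)
    qed
    have "?g n \<le> \<bar>h + shift \<beta>\<bar>" for n
    proof -
      have "ln (Z \<beta> h n) \<le> \<bar>h + shift \<beta>\<bar> * 2 ^ n"
        using Z_le_exp[of \<beta> h n] Z_pos[of \<beta> h n] by (metis ln_exp ln_le_cancel_iff exp_gt_zero)
      then have "?f n \<le> \<bar>h + shift \<beta>\<bar>" by (simp add: divide_le_eq)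
      moreover have "0 \<le> ln B / 2 ^ n" using B by simp
      ultimately show ?thesis by linarith
    qed
    then obtain L where L: "?g \<longlonglongrightarrow> L" using incseq_convergent[OF inc] by blast
    then have "(\<lambda>n. ?g n + ln B / 2 ^ n) \<longlonglongrightarrow> L + 0" by (intro tendsto_add B0)
    then have "L = annealed_free_energy B \<kappa> \<beta> h"
      unfolding annealed_free_energy_def by (simp add: limI)
    \<comment> \<open>An increasing sequence with limit 0 is nonpositive, so Z \<le> B at all
      scales; the geometric growth then improves B to 1.\<close>
    then have "?g n \<le> 0" for n using incseq_le[OF inc L] F by simp
    then have le: "ln (Z \<beta> h n) \<le> ln B" for n by (simp add: divide_le_cancel)
    have "Z \<beta> h n \<le> B" for n using le[of n] Z_pos[of \<beta> h n] B by simp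
    then show "\<forall>n. Z \<beta> h n \<le> 1" using Z_bounded_imp_le_1 by blast
  }
  {
    assume Z: "\<forall>n. Z \<beta> h n \<le> 1"
    have "?f \<longlonglongrightarrow> 0"
    proof (rule tendsto_sandwich)
      \<comment> \<open>The killing probability bounds Z from below only from scale 1 on; at scale 0
        no killing occurs.\<close>
      show "eventually (\<lambda>n. ln (1 - 1 / B) / 2 ^ n \<le> ?f n) sequentially"
        using eventually_ge_at_top[of 1]
      proof eventually_elim
        case (elim n)
        have "ln (1 - 1 / B) \<le> ln (Z \<beta> h n)" using Z_ge[OF elim] B by (intro ln_mono) auto
        then show ?case by (intro divide_right_mono) auto
      qed
      show "eventually (\<lambda>n. ?f n \<le> 0) sequentially"
        using Z Z_pos by (simp add: divide_le_0_iff)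
    qed (use B0 in auto)
    then show "annealed_free_energy B \<kappa> \<beta> h = 0"
      unfolding annealed_free_energy_def by (rule limI)
  }
qed

lemma isCont_Z: "isCont (\<lambda>h. Z \<beta> h n) h"
  unfolding annealed_partition_def E_eq_sum annealed_hamiltonian_def by (intro continuous_intros)

abbreviation h\<^sub>c :: "real \<Rightarrow> real" where
  "h\<^sub>c \<equiv> annealed_critical_point B \<kappa>"

text \<open>The fields with Z \<le> 1 at all scales form a set that is closed by continuity in h,
  bounded above through scale 0, and nonempty. Its supremum, the critical point, therefore belongs
  to it, and no larger field does.\<close>

lemma
  shows Z_critical_le_1: "Z \<beta> (h\<^sub>c \<beta>) n \<le> 1"
    and Z_supercritical: "h\<^sub>c \<beta> < h \<Longrightarrow> \<exists>n. 1 < Z \<beta> h n"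
proof -
  let ?A = "{h. \<forall>n. Z \<beta> h n \<le> 1}"
  have hc: "h\<^sub>c \<beta> = Sup ?A"
    by (simp add: annealed_critical_point_def annealed_free_energy_eq_0_iff)
  have bdd: "bdd_above ?A"
  proof (rule bdd_aboveI)
    fix h assume "h \<in> ?A"
    then have "Z \<beta> h 0 \<le> 1" by blast
    then show "h \<le> - \<beta>\<^sup>2 / 2" by (simp add: Z_0)
  qed
  have "closed {h. Z \<beta> h n \<le> 1}" for n
    using isCont_Z by (intro closed_Collect_le continuous_at_imp_continuous_on) auto
  then have "closed ?A" using closed_Collect_all[of "\<lambda>n h. Z \<beta> h n \<le> 1"] by simp
  moreover have "- shift \<beta> \<in> ?A" using Z_le_1_of_small_h by blast
  ultimately have "h\<^sub>c \<beta> \<in> ?A" unfolding hc using bdd by (intro closed_contains_Sup) auto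
  then show "Z \<beta> (h\<^sub>c \<beta>) n \<le> 1" by blast
  show "\<exists>n. 1 < Z \<beta> h n" if "h\<^sub>c \<beta> < h"
  proof (rule ccontr)
    assume "\<not> (\<exists>n. 1 < Z \<beta> h n)"
    then have "h \<in> ?A" by (simp add: not_less)
    then have "h \<le> h\<^sub>c \<beta>" unfolding hc using bdd by (rule cSup_upper)
    then show False using that by simp
  qed
qed

section \<open>Lower bounds at criticality\<close>

definition gap :: "real \<Rightarrow> real" where
  "gap \<beta> = 8 * \<beta>\<^sup>2 / (B * (1 - q))"

text \<open>The identity makes \<open>gap\<close> the fixed point of the backward step for 1 - Z
  with source 8 \<beta>^2. The bound 1/2 serves the logarithm in the theorem, the bound 2 - B the
  quadratic term of the recursion.\<close>

lemma gap_bounds: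
  assumes "small \<beta>"
  shows "0 \<le> gap \<beta>" "gap \<beta> \<le> 1 / 2" "B * gap \<beta> \<le> 2 - B" "B * gap \<beta> * q + 8 * \<beta>\<^sup>2 = B * gap \<beta>"
proof -
  show g0: "0 \<le> gap \<beta>" using B q_bounds by (simp add: gap_def)
  have Bg: "B * gap \<beta> = 8 * \<beta>\<^sup>2 / (1 - q)" using B by (simp add: gap_def)
  have "B * gap \<beta> \<le> 1 / 2" unfolding Bg using assms q_bounds by (simp add: small_def field_simps)
  then show "gap \<beta> \<le> 1 / 2" using mult_right_mono[of 1 B "gap \<beta>"] g0 B by simp
  show "B * gap \<beta> \<le> 2 - B" unfolding Bg using assms q_bounds by (simp add: small_def divide_le_eq)
  show "B * gap \<beta> * q + 8 * \<beta>\<^sup>2 = B * gap \<beta>" unfolding Bg using q_bounds by (simp add: field_simps)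
qed

text \<open>Since \<open>1\<close> is a repelling fixed point of \<open>z \<mapsto> 1 - 1 / B + z\<^sup>2 / B\<close>, a partition function that
  eventually exceeds \<open>1\<close> must have been close to \<open>1\<close> at all earlier scales.\<close>

lemma Z_before_crossing:
  assumes small: "small \<beta>" and cross: "1 < Z \<beta> h m" and before: "\<And>k. k < m \<Longrightarrow> Z \<beta> h k \<le> 1"
    and "k \<le> m"
  shows "1 - gap \<beta> * q ^ k \<le> Z \<beta> h k"
  using \<open>k \<le> m\<close>
proof (induction k rule: inc_induct)
  case base
  have "0 \<le> gap \<beta> * q ^ m" using gap_bounds[OF small] q_bounds by simp
  then show ?case using cross by linarith
next
  case (step k)
  define y where "y = 1 - Z \<beta> h k"
  note gap = gap_bounds[OF small]
  have y: "0 \<le> y" "y \<le> 1" using before[OF step(2)] Z_pos[of \<beta> h k] by (simp_all add: y_def)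
  have "1 - gap \<beta> * q ^ Suc k \<le> 1 - 1 / B + ((1 - y)\<^sup>2 + 8 * \<beta>\<^sup>2 * q ^ k) / B"
    using step.IH Z_Suc_le[OF small, of k h] before step(2) by (simp add: y_def)
  also have "\<dots> = 1 - (2 * y - y * y - 8 * \<beta>\<^sup>2 * q ^ k) / B"
    using B by (simp add: field_simps power2_eq_square)
  finally have "(2 * y - y * y - 8 * \<beta>\<^sup>2 * q ^ k) / B \<le> gap \<beta> * q ^ Suc k" by simp
  then have "2 * y - y * y \<le> (B * gap \<beta> * q + 8 * \<beta>\<^sup>2) * q ^ k"
    using B by (simp add: divide_le_eq algebra_simps)
  then have le: "2 * y - y * y \<le> B * gap \<beta> * q ^ k" by (simp add: gap(4))
  \<comment> \<open>The estimate is used twice: y^2 \<le> y first gives y \<le> 2 - B, and then y^2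
    \<le> (2 - B) y leaves at least B y on the left.\<close>
  have "y * y \<le> y" using y by (simp add: mult_left_le)
  moreover have "B * gap \<beta> * q ^ k \<le> B * gap \<beta>"
    using gap B q_bounds by (intro mult_left_le power_le_one) auto
  ultimately have "y \<le> 2 - B" using le gap(3) by linarith
  then have "y * y \<le> (2 - B) * y" using y by (intro mult_right_mono)
  then have "B * y \<le> B * (gap \<beta> * q ^ k)" using le by (simp add: algebra_simps)
  then show ?case using B by (simp add: y_def)
qed

text \<open>A violation at scale n would persist for some h slightly above the critical point, with
  Z < 1 up to scale n. The first crossing of 1 for this h lies beyond n, contradicting
  \<open>Z_before_crossing\<close>.\<close>

lemma Z_critical_ge:
  assumes small: "small \<beta>"
  shows "1 - gap \<beta> * q ^ n \<le> Z \<beta> (h\<^sub>c \<beta>) n"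
proof (rule ccontr)
  assume "\<not> ?thesis"
  then have less: "Z \<beta> (h\<^sub>c \<beta>) n < 1 - gap \<beta> * q ^ n" by simp
  have gap0: "0 \<le> gap \<beta> * q ^ n" using gap_bounds[OF small] q_bounds by simp
  \<comment> \<open>A value that reaches 1 stays at least 1. The strict inequalities obtained here
    survive a small increase of h.\<close>
  have less1: "Z \<beta> (h\<^sub>c \<beta>) m < 1" if "m \<le> n" for m
  proof (rule ccontr)
    assume "\<not> Z \<beta> (h\<^sub>c \<beta>) m < 1"
    then have m: "1 \<le> Z \<beta> (h\<^sub>c \<beta>) m" by simp
    have "0 \<le> (2 / B) ^ (n - m) * (Z \<beta> (h\<^sub>c \<beta>) m - 1)" using m B by simp
    then have "1 \<le> Z \<beta> (h\<^sub>c \<beta>) n" using Z_growth[OF m, of "n - m"] that by simp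
    then show False using less gap0 by linarith
  qed
  have ev: "\<forall>\<^sub>F h in at_right (h\<^sub>c \<beta>). Z \<beta> h m < c" if "Z \<beta> (h\<^sub>c \<beta>) m < c" for m c
    using order_tendstoD(2)[OF isContD[OF isCont_Z] that] filter_leD[OF at_le[OF subset_UNIV]] by blast
  have "\<forall>\<^sub>F h in at_right (h\<^sub>c \<beta>). \<forall>m\<in>{..n}. Z \<beta> h m < 1"
    using ev less1 by (intro eventually_ball_finite) auto
  moreover note ev[OF less]
  moreover have "\<forall>\<^sub>F h in at_right (h\<^sub>c \<beta>). h\<^sub>c \<beta> < h" by (rule eventually_at_right_less)
  ultimately have "\<forall>\<^sub>F h in at_right (h\<^sub>c \<beta>).
      h\<^sub>c \<beta> < h \<and> (\<forall>m\<in>{..n}. Z \<beta> h m < 1) \<and> Z \<beta> h n < 1 - gap \<beta> * q ^ n"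
    by eventually_elim blast
  then obtain h where h: "h\<^sub>c \<beta> < h" "\<forall>m\<in>{..n}. Z \<beta> h m < 1" "Z \<beta> h n < 1 - gap \<beta> * q ^ n"
    using eventually_happens'[OF trivial_limit_at_right_real] by blast
  define m where "m = (LEAST m. 1 < Z \<beta> h m)"
  have m: "1 < Z \<beta> h m" using Z_supercritical[OF h(1)] unfolding m_def by (rule LeastI_ex)
  have before: "Z \<beta> h k \<le> 1" if "k < m" for k
    using not_less_Least[of k "\<lambda>m. 1 < Z \<beta> h m"] that by (simp add: m_def)
  have "n \<le> m" using h(2) m by (metis atMost_iff nle_le not_less_iff_gr_or_eq)
  then show False using Z_before_crossing[OF small m before] h(3) by force
qed

text \<open>Discarding the interaction leaves a product over the halves. An empty half is bounded
  through Z at cost a q^n; this happens for at most one half and is charged to the sites of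
  \<open>I\<close>. The extra 1 in the exponent pays for the single site at scale 0.\<close>

lemma T_ge:
  assumes a: "0 \<le> a" and Z: "\<And>n. exp (- a * q ^ n) \<le> Z \<beta> h n"
    and I: "I \<subseteq> {1..2 ^ n}" "I \<noteq> {}"
  shows "exp (- (a * (1 + (\<Sum>j<n. q ^ j))) * real (card I)) * p n I \<le> T \<beta> h n I"
  using I
proof (induction n arbitrary: I)
  case 0
  then have "I = {1}" by auto
  then show ?case using Z[of 0] T_0[where I = I and \<beta> = \<beta> and h = h] p_0[of I] Z_0[of \<beta> h] by simp
next
  case (Suc n)
  define c where "c = a * (1 + (\<Sum>j<n. q ^ j))"
  have fin: "finite I" using Suc.prems(1) finite_subset by blast
  have "0 < card I" using Suc.prems fin by (simp add: card_gt_0_iff)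
  define e where "e = (\<lambda>I :: nat set. c * real (card I) + (if I = {} then a * q ^ n else 0))"
  have half: "exp (- e J) * p n J \<le> T \<beta> h n J" if J: "J \<subseteq> {1..2 ^ n}" for J
    using Suc.IH[OF J] Z[of n] by (cases "J = {}") (auto simp: e_def c_def Z_eq_T)
  have aq: "0 \<le> a * q ^ n" using a q_bounds by simp
  have e: "e (left_half n I) + e (right_half n I) \<le> (c + a * q ^ n) * real (card I)"
  proof -
    have "a * q ^ n \<le> a * q ^ n * real (card I)"
      using mult_left_mono[of 1 "real (card I)" "a * q ^ n"] aq \<open>0 < card I\<close> by simp
    then have "e (left_half n I) + e (right_half n I) \<le> c * real (card I) + a * q ^ n * real (card I)"
      using card_halves[OF fin, of n] \<open>0 < card I\<close> aq by (auto simp: e_def algebra_simps)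
    then show ?thesis by (simp add: distrib_right)
  qed
  have "exp (- (a * (1 + (\<Sum>j<Suc n. q ^ j))) * real (card I)) * p (Suc n) I
      = exp (- ((c + a * q ^ n) * real (card I))) * (p n (left_half n I) * p n (right_half n I)) / B"
    using Suc.prems fin by (simp add: E_prod_Suc c_def algebra_simps)
  also have "\<dots> \<le> exp (- (e (left_half n I) + e (right_half n I)))
      * (p n (left_half n I) * p n (right_half n I)) / B"
    using e B by (intro divide_right_mono mult_right_mono mult_nonneg_nonneg E_prod_nonneg) auto
  also have "\<dots> = (exp (- e (left_half n I)) * p n (left_half n I))
      * (exp (- e (right_half n I)) * p n (right_half n I)) / B"
    by (simp add: exp_add[symmetric])
  also have "\<dots> \<le> T \<beta> h n (left_half n I) * T \<beta> h n (right_half n I) / B"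
    using B Suc.prems
    by (intro divide_right_mono mult_mono half left_half_subset right_half_subset T_nonneg
        mult_nonneg_nonneg E_prod_nonneg) auto
  also have "\<dots> \<le> T \<beta> h (Suc n) I"
    using T_Suc[OF fin, where n = n and \<beta> = \<beta> and h = h] Suc.prems B tilted_pair_ge by (simp add: divide_right_mono)
  finally show ?case .
qed

end

section \<open>Choice of the constants and conclusion\<close>

theorem proposition3p2:
  fixes B \<kappa> :: real
  assumes "1 < B" and "B < 2"
    and "0 < \<kappa>" and "\<kappa> < min (B\<^sup>2 / 4) (1 / 2)"
  shows "\<exists>\<beta>\<^sub>0 > 0. \<exists>c\<^sub>1 > 0. \<exists>c\<^sub>2 > 0. \<forall>\<beta> n. 0 \<le> \<beta> \<and> \<beta> \<le> \<beta>\<^sub>0 \<longrightarrow>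
    (\<forall>I. I \<noteq> {} \<and> I \<subseteq> {1..2 ^ n} \<longrightarrow>
      exp (- c\<^sub>1 * \<beta>\<^sup>2) ^ card I * measure_pmf.expectation (hier_pmf B n) (\<lambda>\<delta>. \<Prod>i\<in>I. \<delta> i)
        \<le> measure_pmf.expectation (hier_pmf B n)
            (\<lambda>\<delta>. (\<Prod>i\<in>I. \<delta> i) *
              exp (annealed_hamiltonian \<kappa> \<beta> (annealed_critical_point B \<kappa> \<beta>) n \<delta>)) \<and>
      measure_pmf.expectation (hier_pmf B n)
            (\<lambda>\<delta>. (\<Prod>i\<in>I. \<delta> i) *
              exp (annealed_hamiltonian \<kappa> \<beta> (annealed_critical_point B \<kappa> \<beta>) n \<delta>))
        \<le> exp (c\<^sub>1 * \<beta>\<^sup>2) ^ card I * measure_pmf.expectation (hier_pmf B n) (\<lambda>\<delta>. \<Prod>i\<in>I. \<delta> i)) \<and>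
    exp (- c\<^sub>2 * \<beta>\<^sup>2 * (4 * \<kappa> / B\<^sup>2) ^ n)
      \<le> annealed_partition B \<kappa> \<beta> (annealed_critical_point B \<kappa> \<beta>) n \<and>
    annealed_partition B \<kappa> \<beta> (annealed_critical_point B \<kappa> \<beta>) n \<le> 1"
proof -
  interpret hier_pinning B \<kappa>
    using assms by unfold_locales auto
  \<comment> \<open>One entry for each inequality of \<open>small\<close>, solved for
    \<beta>^2.\<close>
  define s where "s = Min {(1 - 2 * \<kappa>) / 8, (B - 1) / 32, (1 - r) / (8 * K), (1 - q) / 16, (2 - B) * (1 - q) / 8}"
  \<comment> \<open>Twice \<open>gap\<close> divided by \<beta>^2: the factor 2 comes from 1 - t
    \<ge> exp (- 2 t) for 0 \<le> t \<le> 1/2.\<close>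
  define c\<^sub>2 where "c\<^sub>2 = 16 / (B * (1 - q))"
  \<comment> \<open>The first summand is the limit of \<open>cost\<close> over \<beta>^2 and gives
    the upper bound; the second bounds the exponent of \<open>T_ge\<close>.\<close>
  define c\<^sub>1 where "c\<^sub>1 = 2 * K / (1 - r) + c\<^sub>2 * (1 + 1 / (1 - q))"
  have s: "0 < s" using B \<kappa> K_pos r_bounds q_bounds by (simp add: s_def)
  have small: "small \<beta>" if "0 \<le> \<beta>" "\<beta> \<le> sqrt s" for \<beta>
  proof -
    have "\<beta>\<^sup>2 \<le> (sqrt s)\<^sup>2" using that by (intro power_mono)
    then have "\<beta>\<^sup>2 \<le> s" using s by simp
    then show ?thesis using K_pos by (simp add: s_def small_def field_simps)
  qed
  have c\<^sub>2: "0 < c\<^sub>2" using B q_bounds by (simp add: c\<^sub>2_def)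
  have c\<^sub>1: "0 < c\<^sub>1" unfolding c\<^sub>1_def
    using K_pos r_bounds q_bounds c\<^sub>2 by (intro add_pos_pos mult_pos_pos divide_pos_pos) auto
  have Z_lower: "exp (- (c\<^sub>2 * \<beta>\<^sup>2) * q ^ n) \<le> Z \<beta> (h\<^sub>c \<beta>) n" if "small \<beta>" for \<beta> n
  proof -
    define t where "t = gap \<beta> * q ^ n"
    have t: "0 \<le> t" "t \<le> 1 / 2"
      using gap_bounds[OF that] q_bounds mult_left_le[of "q ^ n" "gap \<beta>"] by (simp_all add: t_def power_le_one)
    have "t * t \<le> t * (1 / 2)" using t by (intro mult_left_mono)
    then have "- 2 * t \<le> ln (1 - t)"
      using ln_one_minus_pos_lower_bound[of t] t by (simp add: power2_eq_square)
    then have "exp (- 2 * t) \<le> exp (ln (1 - t))" by (simp only: exp_le_cancel_iff)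
    also have "\<dots> = 1 - t" using t by simp
    also have "\<dots> \<le> Z \<beta> (h\<^sub>c \<beta>) n" using Z_critical_ge[OF that] by (simp add: t_def)
    also have "- 2 * t = - (c\<^sub>2 * \<beta>\<^sup>2) * q ^ n" by (simp add: t_def gap_def c\<^sub>2_def)
    finally show ?thesis .
  qed
  have upper: "T \<beta> (h\<^sub>c \<beta>) n I \<le> exp (c\<^sub>1 * \<beta>\<^sup>2) ^ card I * p n I"
    if "small \<beta>" "I \<subseteq> {1..2 ^ n}" for \<beta> n I
  proof -
    have "cost \<beta> n \<le> 2 * K / (1 - r) * \<beta>\<^sup>2" using cost_le[of \<beta> n] by simp
    also have "\<dots> \<le> c\<^sub>1 * \<beta>\<^sup>2"
      unfolding c\<^sub>1_def using c\<^sub>2 q_bounds by (intro mult_right_mono) auto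
    finally have "exp (cost \<beta> n * real (card I)) \<le> exp (c\<^sub>1 * \<beta>\<^sup>2 * real (card I))"
      by (simp add: mult_right_mono)
    then have "exp (cost \<beta> n * real (card I)) * p n I \<le> exp (c\<^sub>1 * \<beta>\<^sup>2 * real (card I)) * p n I"
      by (intro mult_right_mono E_prod_nonneg)
    moreover have "T \<beta> (h\<^sub>c \<beta>) n I \<le> exp (cost \<beta> n * real (card I)) * p n I"
      using that Z_critical_le_1 by (intro T_le)
    ultimately show ?thesis by (simp add: exp_of_nat2_mult)
  qed
  have lower: "exp (- c\<^sub>1 * \<beta>\<^sup>2) ^ card I * p n I \<le> T \<beta> (h\<^sub>c \<beta>) n I"
    if "small \<beta>" "I \<subseteq> {1..2 ^ n}" "I \<noteq> {}" for \<beta> n I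
  proof -
    have "c\<^sub>2 * \<beta>\<^sup>2 * (1 + (\<Sum>j<n. q ^ j)) \<le> c\<^sub>2 * \<beta>\<^sup>2 * (1 + 1 / (1 - q))"
      using c\<^sub>2 q_bounds by (intro mult_left_mono add_left_mono geometric_sum_le) auto
    also have "\<dots> = c\<^sub>2 * (1 + 1 / (1 - q)) * \<beta>\<^sup>2" by simp
    also have "\<dots> \<le> c\<^sub>1 * \<beta>\<^sup>2"
      unfolding c\<^sub>1_def using K_pos r_bounds by (intro mult_right_mono) auto
    finally have "exp (- (c\<^sub>1 * \<beta>\<^sup>2) * real (card I)) * p n I
        \<le> exp (- (c\<^sub>2 * \<beta>\<^sup>2 * (1 + (\<Sum>j<n. q ^ j))) * real (card I)) * p n I"
      by (intro mult_right_mono E_prod_nonneg) (simp add: mult_right_mono)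
    also have "\<dots> \<le> T \<beta> (h\<^sub>c \<beta>) n I"
      using c\<^sub>2 that Z_lower by (intro T_ge) auto
    finally show ?thesis using exp_of_nat2_mult[of "- c\<^sub>1 * \<beta>\<^sup>2" "card I"] by simp
  qed
  show ?thesis
  proof (rule exI[of _ "sqrt s"], rule conjI, simp add: s, rule exI[of _ c\<^sub>1], rule conjI, rule c\<^sub>1,
      rule exI[of _ c\<^sub>2], rule conjI, rule c\<^sub>2, intro allI impI conjI)
    fix \<beta> :: real and n assume "0 \<le> \<beta> \<and> \<beta> \<le> sqrt s"
    then have \<beta>: "small \<beta>" using small by blast
    show "exp (- c\<^sub>2 * \<beta>\<^sup>2 * (4 * \<kappa> / B\<^sup>2) ^ n) \<le> Z \<beta> (h\<^sub>c \<beta>) n"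
      using Z_lower[OF \<beta>, of n] by (simp add: q_def)
    show "Z \<beta> (h\<^sub>c \<beta>) n \<le> 1" by (rule Z_critical_le_1)
    fix I :: "nat set" assume "I \<noteq> {} \<and> I \<subseteq> {1..2 ^ n}"
    then have I: "I \<noteq> {}" "I \<subseteq> {1..2 ^ n}" by auto
    show "exp (- c\<^sub>1 * \<beta>\<^sup>2) ^ card I * p n I \<le> T \<beta> (h\<^sub>c \<beta>) n I" by (rule lower[OF \<beta> I(2,1)])
    show "T \<beta> (h\<^sub>c \<beta>) n I \<le> exp (c\<^sub>1 * \<beta>\<^sup>2) ^ card I * p n I" by (rule upper[OF \<beta> I(2)])
  qed
qed

end
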